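(* Let $D$ and $E$ be dcpo's and $U\in\sigma(D\times E)$. Then $$\int_{x\in D}\int_{y\in E}\chi_U(x,y)\,d\xi\,d\nu=\int_{y\in E}\int_{x\in D}\chi_U(x,y)\,d\nu\,d\xi$$ holds for all $(\nu,\xi)\in\mathcal{P} D\times\mathcal{V} E$ (equivalently, for all $(\nu,\xi)\in\mathcal{V} D\times\mathcal{P} E$).
   Context: For a dcpo $D$, $\sigma D$ is its Scott topology and $\sigma(D\times E)$ the Scott topology of the product dcpo. $\mathcal{V} D$ is the set of subprobability valuations on $(D,\sigma D)$: Scott-continuous $\nu\colon\sigma D\to[0,1]$ with $\nu(\emptyset)=0$ and $\nu(U)+\nu(V)=\nu(U\cup V)+\nu(U\cap V)$, ordered pointwise. The weak topology on $\mathcal{V} D$ is generated by the sets $\{\nu\mid\nu(U)>r\}$ ($U\in\sigma D$, $r\in[0,1]$); $\mathcal{V}_w D$ denotes this space. A $T_0$ space is sober if every nonempty irreducible closed subset is the closure of a unique singleton. $\mathcal{P} D$ is the intersection of all sober subspaces of $\mathcal{V}_w D$ (with relative topology) containing all simple valuations $\sum_{i=1}^n r_i\delta_{x_i}$ ($r_i>0$, $\sum r_i\le1$, $\delta_x$ the Dirac valuation). For Scott-continuous $f\colon D\to[0,1]$, $\int_{x\in D}f(x)\,d\nu:=\int_0^1\nu(f^{-1}((t,1]))\,dt$ (Riemann integral); $\chi_U$ is the characteristic function of $U$. *)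

theory Defs
  imports "HOL-Analysis.Analysis" "HOL-Library.Lub_Glb" "HOL-Library.Product_Order"
begin

text \<open>
  A poset is a carrier set \<open>D\<close> (possibly empty) in some partially ordered type, with the
  inherited order; least upper bounds are taken relative to the carrier, via \<^const>\<open>isLub\<close>.
  On pairs the order is the componentwise one.
\<close>

definition directed_set :: "'a::order set \<Rightarrow> bool" where
  "directed_set S \<longleftrightarrow> S \<noteq> {} \<and> (\<forall>x\<in>S. \<forall>y\<in>S. \<exists>z\<in>S. x \<le> z \<and> y \<le> z)"

definition dcpo :: "'a::order set \<Rightarrow> bool" where
  "dcpo D \<longleftrightarrow> (\<forall>S\<subseteq>D. directed_set S \<longrightarrow> (\<exists>x. isLub D S x))"

definition scott_open :: "'a::order set \<Rightarrow> 'a set \<Rightarrow> bool" where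
  "scott_open D U \<longleftrightarrow> U \<subseteq> D \<and> (\<forall>x\<in>U. \<forall>y\<in>D. x \<le> y \<longrightarrow> y \<in> U) \<and>
     (\<forall>S\<subseteq>D. \<forall>x\<in>U. directed_set S \<and> isLub D S x \<longrightarrow> S \<inter> U \<noteq> {})"

definition scott_topology :: "'a::order set \<Rightarrow> 'a topology" where
  "scott_topology D = topology (scott_open D)"

abbreviation scott_opens :: "'a::order set \<Rightarrow> 'a set set" where
  "scott_opens D \<equiv> {U. openin (scott_topology D) U}"

lemma scott_openD:
  assumes "scott_open D U"
  shows "U \<subseteq> D"
    and "\<And>x y. x \<in> U \<Longrightarrow> y \<in> D \<Longrightarrow> x \<le> y \<Longrightarrow> y \<in> U"
    and "\<And>S x. S \<subseteq> D \<Longrightarrow> x \<in> U \<Longrightarrow> directed_set S \<Longrightarrow> isLub D S x \<Longrightarrow> S \<inter> U \<noteq> {}"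
  using assms unfolding scott_open_def by simp_all metis+

lemma istopology_scott_open: "istopology (scott_open D)"
  unfolding istopology_def
proof (intro conjI allI impI)
  fix U V assume U: "scott_open D U" and V: "scott_open D V"
  have "S \<inter> (U \<inter> V) \<noteq> {}"
    if "S \<subseteq> D" "x \<in> U \<inter> V" and S: "directed_set S" "isLub D S x" for S x
  proof -
    have "S \<inter> U \<noteq> {}" "S \<inter> V \<noteq> {}"
      using scott_openD(3)[OF U] scott_openD(3)[OF V] that by (metis IntD1 IntD2)+
    then obtain a b where ab: "a \<in> S" "a \<in> U" "b \<in> S" "b \<in> V"
      by auto
    with S(1) obtain c where c: "c \<in> S" "a \<le> c" "b \<le> c"
      unfolding directed_set_def by metis
    then have "c \<in> D" using \<open>S \<subseteq> D\<close> by auto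
    then have "c \<in> U" "c \<in> V"
      using ab c scott_openD(2)[OF U] scott_openD(2)[OF V] by metis+
    with c(1) show ?thesis by auto
  qed
  with U V show "scott_open D (U \<inter> V)"
    by (auto simp: scott_open_def)
next
  fix K assume K: "\<forall>U\<in>K. scott_open D U"
  have "S \<inter> \<Union>K \<noteq> {}"
    if "S \<subseteq> D" "x \<in> U" "U \<in> K" "directed_set S" "isLub D S x" for S x U
  proof -
    from K that have "S \<inter> U \<noteq> {}"
      by (metis scott_openD(3))
    with that show ?thesis by auto
  qed
  moreover have "y \<in> \<Union>K" if "x \<in> U" "U \<in> K" "y \<in> D" "x \<le> y" for x y U
    using K that unfolding scott_open_def by (meson UnionI)
  moreover have "\<Union>K \<subseteq> D"
    using K by (auto simp: scott_open_def)
  ultimately show "scott_open D (\<Union>K)"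
    unfolding scott_open_def by (metis UnionE)
qed

lemma openin_scott_topology: "openin (scott_topology D) U \<longleftrightarrow> scott_open D U"
  by (simp add: scott_topology_def istopology_scott_open topology_inverse')

definition scott_continuous_on :: "'a::order set \<Rightarrow> 'b::order set \<Rightarrow> ('a \<Rightarrow> 'b) \<Rightarrow> bool" where
  "scott_continuous_on D E f \<longleftrightarrow> f \<in> D \<rightarrow> E \<and> mono_on D f \<and>
     (\<forall>S\<subseteq>D. \<forall>x. directed_set S \<and> isLub D S x \<longrightarrow> isLub E (f ` S) (f x))"

text \<open>
  Valuations have the Scott-open sets as their domain, hence the extensional function space:
  without it, valuations could differ outside their domain and the weak topology would not be
  \<open>T\<^sub>0\<close>. The order on \<^term>\<open>scott_opens D\<close> is inclusion.
\<close>

definition valuations :: "'a::order set \<Rightarrow> ('a set \<Rightarrow> real) set" where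
  "valuations D = {\<nu> \<in> scott_opens D \<rightarrow>\<^sub>E {0..1}.
     scott_continuous_on (scott_opens D) {0..1} \<nu> \<and> \<nu> {} = 0 \<and>
     (\<forall>U\<in>scott_opens D. \<forall>V\<in>scott_opens D. \<nu> U + \<nu> V = \<nu> (U \<union> V) + \<nu> (U \<inter> V))}"

text \<open>
  The whole space is added to the subbasis because the sets \<open>{\<nu>. r < \<nu> U}\<close> with \<open>r \<ge> 0\<close> do not
  cover the zero valuation.
\<close>

definition weak_topology :: "'a::order set \<Rightarrow> ('a set \<Rightarrow> real) topology" where
  "weak_topology D = topology_generated_by
     (insert (valuations D)
       {{\<nu> \<in> valuations D. \<nu> U > r} | U r. openin (scott_topology D) U \<and> r \<in> {0..1}})"

definition irreducible_closedin :: "'a topology \<Rightarrow> 'a set \<Rightarrow> bool" where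
  "irreducible_closedin X C \<longleftrightarrow> closedin X C \<and> C \<noteq> {} \<and>
     (\<forall>A B. closedin X A \<and> closedin X B \<and> C \<subseteq> A \<union> B \<longrightarrow> C \<subseteq> A \<or> C \<subseteq> B)"

definition sober_space :: "'a topology \<Rightarrow> bool" where
  "sober_space X \<longleftrightarrow> t0_space X \<and>
     (\<forall>C. irreducible_closedin X C \<longrightarrow> (\<exists>!x. x \<in> topspace X \<and> C = X closure_of {x}))"

definition dirac :: "'a::order set \<Rightarrow> 'a \<Rightarrow> 'a set \<Rightarrow> real" where
  "dirac D x = (\<lambda>U\<in>scott_opens D. if x \<in> U then 1 else 0)"

text \<open>The empty sum \<open>n = 0\<close> is allowed, so the zero valuation is simple.\<close>

definition simple_valuations :: "'a::order set \<Rightarrow> ('a set \<Rightarrow> real) set" where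
  "simple_valuations D = {\<lambda>U\<in>scott_opens D. \<Sum>i=1..n. r i * dirac D (x i) U | (n::nat) r x.
     (\<forall>i\<in>{1..n}. r i > 0 \<and> x i \<in> D) \<and> (\<Sum>i=1..n. r i) \<le> 1}"

definition p_valuations :: "'a::order set \<Rightarrow> ('a set \<Rightarrow> real) set" where
  "p_valuations D = \<Inter>{S. S \<subseteq> valuations D \<and> simple_valuations D \<subseteq> S \<and>
     sober_space (subtopology (weak_topology D) S)}"

text \<open>
  For Scott-continuous \<open>f\<close> the integrand below is antitone in \<open>t\<close>, hence Riemann integrable, and
  the Henstock-Kurzweil integral is its Riemann integral.
\<close>

definition val_integral :: "'a::order set \<Rightarrow> ('a set \<Rightarrow> real) \<Rightarrow> ('a \<Rightarrow> real) \<Rightarrow> real" where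
  "val_integral D \<nu> f = integral {0..1} (\<lambda>t. \<nu> {x \<in> D. f x \<in> {t<..1}})"

end

theory Submission
  imports Defs
begin

text \<open>
  Write \<open>U\<^sub>x\<close> and \<open>U\<^sup>y\<close> for the sections of \<open>U\<close>; the iterated integrals are those of \<open>\<xi> (U\<^sub>x)\<close> against
  \<open>\<nu>\<close> and of \<open>\<nu> (U\<^sup>y)\<close> against \<open>\<xi>\<close>. The first is weakly lower semicontinuous in \<open>\<nu>\<close>, but the second
  is only monotone and Scott-continuous, so the two inequalities need different arguments.

  Call \<open>\<nu>\<close> point-continuous if each bound \<open>t < \<nu> V\<close> is already forced by a finite subset of \<open>V\<close>. The
  point-continuous \<open>\<nu>\<close> whose first iterated integral is at most the second form a sober subspace
  containing the simple valuations: point-continuity and the inequality pass to the generic point of an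
  irreducible closed set, which is its pointwise supremum. Hence this subspace contains
  \<^term>\<open>p_valuations D\<close>.

  Conversely, for point-continuous \<open>\<nu>\<close> the set \<open>{y. \<nu> (U\<^sup>y) > t}\<close> is a union of finite intersections of
  sections \<open>U\<^sub>x\<close>, so up to \<open>\<epsilon>\<close> the second integral only depends on finitely many \<open>U\<^sub>x\<close>. Decomposing
  \<open>\<xi>\<close> over the atoms of the algebra they generate bounds it by the first integral.
\<close>

section \<open>Integrals of antitone functions\<close>

lemma antimono_integrable_on:
  fixes h :: "real \<Rightarrow> real"
  assumes "antimono h"
  shows "h integrable_on {a..b}"
proof -
  have "mono_on {a..b} (\<lambda>t. - h t)"
    using assms by (auto simp: mono_on_def antimono_def)
  then have "(\<lambda>t. - h t) integrable_on {a..b}"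
    by (rule integrable_on_mono_on)
  from integrable_neg[OF this] show ?thesis by simp
qed

lemma antimono_integral_step:
  fixes h :: "real \<Rightarrow> real"
  assumes "antimono h" "a \<le> b"
  shows "h b * (b - a) \<le> integral {a..b} h" "integral {a..b} h \<le> h a * (b - a)"
proof -
  have h: "h b \<le> h t" "h t \<le> h a" if "t \<in> {a..b}" for t
    using assms that by (auto simp: antimono_def)
  have "integral {a..b} (\<lambda>_. h b) \<le> integral {a..b} h"
    by (rule integral_le) (use h antimono_integrable_on[OF assms(1)] in auto)
  moreover have "integral {a..b} h \<le> integral {a..b} (\<lambda>_. h a)"
    by (rule integral_le) (use h antimono_integrable_on[OF assms(1)] in auto)
  ultimately show "h b * (b - a) \<le> integral {a..b} h" "integral {a..b} h \<le> h a * (b - a)"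
    using assms(2) by (simp_all add: mult.commute)
qed

text \<open>The cells have width \<open>1 / n\<close>. Monotonicity on each cell puts the integral
  between the right and the left endpoint sum, and these differ by the telescoping term
  \<open>(h 0 - h (k / n)) / n\<close>.\<close>

lemma antimono_integral_sums:
  fixes h :: "real \<Rightarrow> real" and n k :: nat
  assumes "antimono h" "0 < n"
  shows "(\<Sum>i=1..k. h (i / n)) / n \<le> integral {0..k / n} h \<and>
         integral {0..k / n} h \<le> (h 0 - h (k / n)) / n + (\<Sum>i=1..k. h (i / n)) / n"
proof (induction k)
  case 0
  then show ?case by simp
next
  case (Suc k)
  let ?a = "real k / n" and ?b = "real (Suc k) / n"
  have ab: "?a \<le> ?b" "?b - ?a = 1 / n"
    using assms(2) by (simp_all add: divide_right_mono diff_divide_distrib[symmetric])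
  have "integral {0..?b} h = integral {0..?a} h + integral {?a..?b} h"
    by (rule Henstock_Kurzweil_Integration.integral_combine[symmetric])
      (use ab assms antimono_integrable_on in auto)
  moreover have "h ?b / n \<le> integral {?a..?b} h" "integral {?a..?b} h \<le> h ?a / n"
    using antimono_integral_step[OF assms(1) ab(1)] unfolding ab(2) by simp_all
  ultimately show ?case
    using Suc.IH by (simp add: add_divide_distrib diff_divide_distrib)
qed

text \<open>The error \<open>1 / n\<close> does not depend on \<open>h\<close>; this uniformity lets
  one \<open>n\<close> serve several valuations at once.\<close>

lemma antimono_integral_bounds:
  fixes h :: "real \<Rightarrow> real" and n :: nat
  assumes "antimono h" "0 < n" "h 0 \<le> 1" "0 \<le> h 1"
  shows "(\<Sum>i=1..n. h (i / n)) / n \<le> integral {0..1} h"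
    and "integral {0..1} h \<le> 1 / n + (\<Sum>i=1..n. h (i / n)) / n"
proof -
  note * = antimono_integral_sums[OF assms(1,2), of n]
  show "(\<Sum>i=1..n. h (i / n)) / n \<le> integral {0..1} h"
    using * assms by simp
  have "(h 0 - h 1) / n \<le> 1 / n"
    using assms by (intro divide_right_mono) auto
  then show "integral {0..1} h \<le> 1 / n + (\<Sum>i=1..n. h (i / n)) / n"
    using * assms by simp
qed

text \<open>The shift moves the window from \<open>{0..T}\<close> to \<open>{-w..T - w}\<close>: it
  gains \<open>{-w..0}\<close>, where \<open>h\<close> is \<open>c\<close> below 0, and loses
  \<open>{T - w..T}\<close>, where \<open>h\<close> vanishes. This computes the effect of adding one
  weighted indicator to a step function.\<close>

lemma antimono_integral_shift_diff:
  fixes h :: "real \<Rightarrow> real"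
  assumes h: "antimono h" and "0 \<le> w" "w \<le> T"
    and neg: "\<And>t. t < 0 \<Longrightarrow> h t = c" and large: "\<And>t. T - w \<le> t \<Longrightarrow> h t = 0"
  shows "integral {0..T} (\<lambda>t. h (t - w)) - integral {0..T} h = w * c"
proof -
  have "integral {0..T} (\<lambda>t. h (t - w)) = integral {-w..T - w} h"
    using integral_shift_real_ivl[of "-w" "-w" "T - w" h] by simp
  also have "\<dots> = integral {-w..0} h + integral {0..T - w} h"
    by (rule Henstock_Kurzweil_Integration.integral_combine[symmetric])
      (use assms antimono_integrable_on in auto)
  \<comment> \<open>\<open>h 0\<close> may differ from \<open>c\<close>; a single point does not
    affect the integral.\<close>
  also have "integral {-w..0} h = integral {-w..0} (\<lambda>_. c)"
    by (rule integral_spike[of "{0}"]) (auto simp: neg)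
  finally have 1: "integral {0..T} (\<lambda>t. h (t - w)) = w * c + integral {0..T - w} h"
    using assms by simp
  have "integral {0..T} h = integral {0..T - w} h + integral {T - w..T} h"
    by (rule Henstock_Kurzweil_Integration.integral_combine[symmetric])
      (use assms antimono_integrable_on in auto)
  also have "integral {T - w..T} h = integral {T - w..T} (\<lambda>_. 0)"
    by (rule integral_cong) (simp add: large)
  finally show ?thesis
    using 1 by simp
qed

section \<open>Scott-open sets and valuations\<close>

lemma isLub_iff:
  "isLub R S x \<longleftrightarrow> x \<in> R \<and> (\<forall>s\<in>S. s \<le> x) \<and> (\<forall>z\<in>R. (\<forall>s\<in>S. s \<le> z) \<longrightarrow> x \<le> z)"
  unfolding isLub_def leastP_def isUb_def setle_def setge_def by blast

lemma scott_open_Int: "scott_open D U \<Longrightarrow> scott_open D V \<Longrightarrow> scott_open D (U \<inter> V)"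
  using openin_Int[of "scott_topology D"] by (simp add: openin_scott_topology)

lemma scott_open_Un: "scott_open D U \<Longrightarrow> scott_open D V \<Longrightarrow> scott_open D (U \<union> V)"
  using openin_Un[of "scott_topology D"] by (simp add: openin_scott_topology)

lemma scott_open_Union: "(\<And>V. V \<in> K \<Longrightarrow> scott_open D V) \<Longrightarrow> scott_open D (\<Union>K)"
  using openin_Union[of K "scott_topology D"] by (simp add: openin_scott_topology)

lemma scott_open_empty: "scott_open D {}"
  by (simp add: scott_open_def)

lemma scott_open_space: "scott_open D D"
  unfolding scott_open_def directed_set_def by blast

lemma valuationsD:
  assumes "\<nu> \<in> valuations D"
  shows "\<nu> \<in> extensional (scott_opens D)"
    and "\<nu> {} = 0"
    and "scott_open D U \<Longrightarrow> 0 \<le> \<nu> U"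
    and "scott_open D U \<Longrightarrow> \<nu> U \<le> 1"
    and "scott_open D U \<Longrightarrow> scott_open D V \<Longrightarrow> U \<subseteq> V \<Longrightarrow> \<nu> U \<le> \<nu> V"
    and "scott_open D U \<Longrightarrow> scott_open D V \<Longrightarrow> \<nu> U + \<nu> V = \<nu> (U \<union> V) + \<nu> (U \<inter> V)"
  using assms
  by (auto simp: valuations_def openin_scott_topology scott_continuous_on_def mono_on_def
      PiE_def Pi_def)

lemma valuation_less_Union:
  assumes \<nu>: "\<nu> \<in> valuations D" and K: "K \<noteq> {}" "\<And>V. V \<in> K \<Longrightarrow> scott_open D V"
    and dir: "\<And>V W. V \<in> K \<Longrightarrow> W \<in> K \<Longrightarrow> \<exists>Z\<in>K. V \<union> W \<subseteq> Z"
    and "t < \<nu> (\<Union>K)"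
  shows "\<exists>V\<in>K. t < \<nu> V"
proof (rule ccontr)
  assume "\<not> ?thesis"
  then have le: "\<nu> V \<le> t" if "V \<in> K" for V
    using that by force
  have "directed_set K"
    using K(1) dir unfolding directed_set_def by (meson Un_subset_iff)
  moreover have "isLub (scott_opens D) K (\<Union>K)"
    using scott_open_Union[of K D] K(2) unfolding isLub_iff
    by (auto simp: openin_scott_topology)
  moreover have "K \<subseteq> scott_opens D"
    using K(2) by (auto simp: openin_scott_topology)
  moreover have "scott_continuous_on (scott_opens D) {0..1} \<nu>"
    using \<nu> by (simp add: valuations_def)
  ultimately have lub: "isLub {0..1} (\<nu> ` K) (\<nu> (\<Union>K))"
    unfolding scott_continuous_on_def by blast
  obtain V where "V \<in> K" using K(1) by blast
  \<comment> \<open>The supremum is taken relative to \<open>{0..1}\<close>, so \<open>t\<close>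
    counts as an upper bound only inside this interval. A member of the nonempty \<open>K\<close>
    gives \<open>0 \<le> t\<close>.\<close>
  then have "t \<in> {0..1}"
    using le[OF \<open>V \<in> K\<close>] valuationsD(3,4)[OF \<nu>] K(2)[OF \<open>V \<in> K\<close>] scott_open_Union[of K D] K(2)
      assms(5) by (meson atLeastAtMost_iff less_eq_real_def order_trans)
  then have "\<nu> (\<Union>K) \<le> t"
    using lub le unfolding isLub_iff by auto
  with assms(5) show False by simp
qed

lemma valuationsI:
  assumes "\<nu> \<in> extensional (scott_opens D)" "\<nu> {} = 0"
    and bounds: "\<And>V. scott_open D V \<Longrightarrow> 0 \<le> \<nu> V \<and> \<nu> V \<le> 1"
    and mono: "\<And>V W. scott_open D V \<Longrightarrow> scott_open D W \<Longrightarrow> V \<subseteq> W \<Longrightarrow> \<nu> V \<le> \<nu> W"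
    and modular: "\<And>V W. scott_open D V \<Longrightarrow> scott_open D W \<Longrightarrow> \<nu> V + \<nu> W = \<nu> (V \<union> W) + \<nu> (V \<inter> W)"
    and cont: "\<And>K t. K \<noteq> {} \<Longrightarrow> (\<And>V. V \<in> K \<Longrightarrow> scott_open D V) \<Longrightarrow>
      (\<And>V W. V \<in> K \<Longrightarrow> W \<in> K \<Longrightarrow> \<exists>Z\<in>K. V \<union> W \<subseteq> Z) \<Longrightarrow> t < \<nu> (\<Union>K) \<Longrightarrow> \<exists>V\<in>K. t < \<nu> V"
  shows "\<nu> \<in> valuations D"
proof -
  have "isLub {0..1} (\<nu> ` K) (\<nu> X)"
    if K: "K \<subseteq> scott_opens D" "directed_set K" and lub: "isLub (scott_opens D) K X" for K X
  proof -
    have op: "scott_open D V" if "V \<in> K" for V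
      using K(1) that by (auto simp: openin_scott_topology)
    have U: "scott_open D (\<Union>K)"
      using op by (rule scott_open_Union)
    then have X: "X = \<Union>K"
      using lub unfolding isLub_iff by (auto simp: openin_scott_topology)
    have "\<nu> X \<le> z" if z: "\<And>V. V \<in> K \<Longrightarrow> \<nu> V \<le> z" for z
    proof (rule ccontr)
      assume "\<not> \<nu> X \<le> z"
      then have "\<exists>V\<in>K. z < \<nu> V"
        using K(2) op unfolding X directed_set_def by (intro cont) auto
      with z show False by force
    qed
    moreover have "\<nu> V \<le> \<nu> X" if "V \<in> K" for V
      using that op U by (intro mono) (auto simp: X)
    ultimately show ?thesis
      using bounds[OF U] unfolding isLub_iff X by auto
  qed
  then show ?thesis
    using assms(1-5)
    by (auto simp: valuations_def scott_continuous_on_def openin_scott_topology mono_on_def PiE_def Pi_def)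
qed

section \<open>Sections of Scott-open sets in a product\<close>

lemma scott_open_Image:
  fixes D :: "'a::order set" and E :: "'b::order set"
  assumes U: "scott_open (D \<times> E) U" and "x \<in> D"
  shows "scott_open E (U `` {x})"
  unfolding scott_open_def
proof (intro conjI ballI allI impI)
  show "U `` {x} \<subseteq> E"
    using scott_openD(1)[OF U] by auto
next
  fix y z assume "y \<in> U `` {x}" "z \<in> E" "y \<le> z"
  then show "z \<in> U `` {x}"
    using scott_openD(2)[OF U, of "(x, y)" "(x, z)"] assms(2) by simp
next
  fix S y assume S: "S \<subseteq> E" and y: "y \<in> U `` {x}" and *: "directed_set S \<and> isLub E S y"
  have "directed_set (Pair x ` S)"
    using * unfolding directed_set_def by fastforce
  moreover have "isLub (D \<times> E) (Pair x ` S) (x, y)"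
    using * \<open>x \<in> D\<close> unfolding isLub_iff directed_set_def by auto
  ultimately have "Pair x ` S \<inter> U \<noteq> {}"
    using S y \<open>x \<in> D\<close> by (intro scott_openD(3)[OF U]) auto
  then show "S \<inter> U `` {x} \<noteq> {}" by auto
qed

text \<open>With the converse relation, sections in the second coordinate become images too, so
  results on sections are proved for one coordinate only.\<close>

lemma scott_open_converse:
  fixes D :: "'a::order set" and E :: "'b::order set"
  assumes U: "scott_open (D \<times> E) U"
  shows "scott_open (E \<times> D) (U\<inverse>)"
  unfolding scott_open_def
proof (intro conjI ballI allI impI)
  show "U\<inverse> \<subseteq> E \<times> D"
    using scott_openD(1)[OF U] by auto
next
  fix p q assume "p \<in> U\<inverse>" "q \<in> E \<times> D" "p \<le> q"
  then show "q \<in> U\<inverse>"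
    using scott_openD(2)[OF U, of "prod.swap p" "prod.swap q"] by (auto simp: less_eq_prod_def)
next
  fix S p assume S: "S \<subseteq> E \<times> D" and p: "p \<in> U\<inverse>" and *: "directed_set S \<and> isLub (E \<times> D) S p"
  have "directed_set (prod.swap ` S)"
    using * unfolding directed_set_def less_eq_prod_def by fastforce
  moreover have "isLub (D \<times> E) (prod.swap ` S) (prod.swap p)"
    using * unfolding isLub_iff less_eq_prod_def by auto
  ultimately have "prod.swap ` S \<inter> U \<noteq> {}"
    using S p by (intro scott_openD(3)[OF U]) auto
  then show "S \<inter> U\<inverse> \<noteq> {}" by force
qed

text \<open>A directed supremum in \<open>x\<close> turns into a directed union of sections, because
  \<open>U\<close> is Scott-open and \<open>y\<close> can be held fixed. Scott-continuity of
  \<open>\<xi>\<close> then finds a member of \<open>S\<close> whose section already has mass above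
  \<open>t\<close>.\<close>

lemma scott_open_superlevel:
  fixes D :: "'a::order set" and E :: "'b::order set"
  assumes U: "scott_open (D \<times> E) U" and \<xi>: "\<xi> \<in> valuations E"
  shows "scott_open D {x \<in> D. t < \<xi> (U `` {x})}"
  unfolding scott_open_def
proof (intro conjI ballI allI impI)
  have mono: "U `` {x} \<subseteq> U `` {x'}" if "x \<le> x'" "x' \<in> D" for x x'
  proof
    fix y assume "y \<in> U `` {x}"
    then have "(x, y) \<in> U" by simp
    moreover from this have "y \<in> E" using scott_openD(1)[OF U] by auto
    ultimately show "y \<in> U `` {x'}"
      using scott_openD(2)[OF U, of "(x, y)" "(x', y)"] that by simp
  qed
  show "{x \<in> D. t < \<xi> (U `` {x})} \<subseteq> D" by auto
  {
    fix x z assume "x \<in> {x \<in> D. t < \<xi> (U `` {x})}" "z \<in> D" "x \<le> z"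
    then show "z \<in> {x \<in> D. t < \<xi> (U `` {x})}"
      using valuationsD(5)[OF \<xi> scott_open_Image[OF U] scott_open_Image[OF U], of x z] mono[of x z]
      by force
  }
  fix S x assume S: "S \<subseteq> D" and x: "x \<in> {x \<in> D. t < \<xi> (U `` {x})}" and *: "directed_set S \<and> isLub D S x"
  have "U `` {x} = (\<Union>s\<in>S. U `` {s})"
  proof
    show "U `` {x} \<subseteq> (\<Union>s\<in>S. U `` {s})"
    proof
      fix y assume "y \<in> U `` {x}"
      then have y: "(x, y) \<in> U" "y \<in> E"
        using scott_openD(1)[OF U] by auto
      have "directed_set ((\<lambda>s. (s, y)) ` S)"
        using * unfolding directed_set_def by fastforce
      moreover have "isLub (D \<times> E) ((\<lambda>s. (s, y)) ` S) (x, y)"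
        using * y(2) unfolding isLub_iff directed_set_def by auto
      ultimately have "(\<lambda>s. (s, y)) ` S \<inter> U \<noteq> {}"
        using S y by (intro scott_openD(3)[OF U]) auto
      then show "y \<in> (\<Union>s\<in>S. U `` {s})" by auto
    qed
    show "(\<Union>s\<in>S. U `` {s}) \<subseteq> U `` {x}"
      using mono * unfolding isLub_iff by blast
  qed
  with x have "t < \<xi> (\<Union>((\<lambda>s. U `` {s}) ` S))"
    by simp
  moreover have "\<exists>Z\<in>(\<lambda>s. U `` {s}) ` S. V \<union> W \<subseteq> Z"
    if VW: "V \<in> (\<lambda>s. U `` {s}) ` S" "W \<in> (\<lambda>s. U `` {s}) ` S" for V W
  proof -
    from VW obtain a b where ab: "a \<in> S" "b \<in> S" "V = U `` {a}" "W = U `` {b}"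
      by auto
    then obtain c where c: "c \<in> S" "a \<le> c" "b \<le> c"
      using * unfolding directed_set_def by meson
    then have "V \<union> W \<subseteq> U `` {c}"
      using mono[of a c] mono[of b c] ab S by blast
    with c(1) show ?thesis by blast
  qed
  ultimately have "\<exists>V\<in>(\<lambda>s. U `` {s}) ` S. t < \<xi> V"
    using * S scott_open_Image[OF U]
    by (intro valuation_less_Union[OF \<xi>]) (auto simp: directed_set_def)
  then show "S \<inter> {x \<in> D. t < \<xi> (U `` {x})} \<noteq> {}"
    using S by auto
qed

section \<open>Integration with respect to a valuation\<close>

text \<open>Amounts to Scott-continuity into \<open>{0..1}\<close>, phrased by superlevel sets.
  Letting \<open>t\<close> range over all reals makes the mass of the superlevel set antitone in
  \<open>t\<close> on the whole line, as the integral lemmas require.\<close>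

definition scott_lsc :: "'a::order set \<Rightarrow> ('a \<Rightarrow> real) \<Rightarrow> bool" where
  "scott_lsc D f \<longleftrightarrow> f ` D \<subseteq> {0..1} \<and> (\<forall>t. scott_open D {x \<in> D. t < f x})"

lemma scott_lsc_valuation_Image:
  assumes "scott_open (D \<times> E) U" "\<xi> \<in> valuations E"
  shows "scott_lsc D (\<lambda>x. \<xi> (U `` {x}))"
  using scott_open_superlevel[OF assms] scott_open_Image[OF assms(1)] valuationsD(3,4)[OF assms(2)]
  by (auto simp: scott_lsc_def)

lemma antimono_valuation_superlevel:
  assumes "\<nu> \<in> valuations D" "\<And>t. scott_open D {x \<in> D. t < f x}"
  shows "antimono (\<lambda>t. \<nu> {x \<in> D. t < f x})"
  using assms by (auto simp: antimono_def intro!: valuationsD(5))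

lemma val_integral_scott_lsc:
  assumes "scott_lsc D f"
  shows "val_integral D \<nu> f = integral {0..1} (\<lambda>t. \<nu> {x \<in> D. t < f x})"
proof -
  have "{x \<in> D. f x \<in> {t<..1}} = {x \<in> D. t < f x}" for t
    using assms by (auto simp: scott_lsc_def)
  then show ?thesis by (simp add: val_integral_def)
qed

lemma val_integral_bounds:
  fixes n :: nat
  assumes f: "scott_lsc D f" and \<nu>: "\<nu> \<in> valuations D" and "0 < n"
  shows "(\<Sum>i=1..n. \<nu> {x \<in> D. i / n < f x}) / n \<le> val_integral D \<nu> f"
    and "val_integral D \<nu> f \<le> 1 / n + (\<Sum>i=1..n. \<nu> {x \<in> D. i / n < f x}) / n"
proof -
  have op: "scott_open D {x \<in> D. t < f x}" for t
    using f by (simp add: scott_lsc_def)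
  note antimono_integral_bounds[OF antimono_valuation_superlevel[OF \<nu> op] \<open>0 < n\<close>
      valuationsD(4)[OF \<nu> op] valuationsD(3)[OF \<nu> op]]
  then show "(\<Sum>i=1..n. \<nu> {x \<in> D. i / n < f x}) / n \<le> val_integral D \<nu> f"
    and "val_integral D \<nu> f \<le> 1 / n + (\<Sum>i=1..n. \<nu> {x \<in> D. i / n < f x}) / n"
    by (simp_all add: val_integral_scott_lsc[OF f])
qed

lemma val_integral_mono:
  assumes f: "scott_lsc D f" and g: "scott_lsc D g" and \<nu>: "\<nu> \<in> valuations D"
    and le: "\<And>x. x \<in> D \<Longrightarrow> f x \<le> g x"
  shows "val_integral D \<nu> f \<le> val_integral D \<nu> g"
proof -
  have op: "scott_open D {x \<in> D. t < f x}" "scott_open D {x \<in> D. t < g x}" for t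
    using f g by (simp_all add: scott_lsc_def)
  show ?thesis
    unfolding val_integral_scott_lsc[OF f] val_integral_scott_lsc[OF g]
    by (rule integral_le)
      (use antimono_integrable_on[OF antimono_valuation_superlevel[OF \<nu> op(1)]]
        antimono_integrable_on[OF antimono_valuation_superlevel[OF \<nu> op(2)]] op le
       in \<open>auto intro!: valuationsD(5)[OF \<nu>] intro: less_le_trans\<close>)
qed

lemma val_integral_indicator:
  assumes "\<xi> \<in> valuations E" "scott_open E V"
  shows "val_integral E \<xi> (indicator V) = \<xi> V"
proof -
  \<comment> \<open>At \<open>t = 1\<close> the interval \<open>{t<..1}\<close> is empty and so is
    the superlevel set; hence this point is left out.\<close>
  have "{y \<in> E. (indicator V y :: real) \<in> {t<..1}} = V" if "t \<in> {0..1} - {1}" for t :: real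
    using that scott_openD(1)[OF assms(2)] by (auto simp: indicator_def split: if_splits)
  then have "integral {0..1} (\<lambda>t. \<xi> {y \<in> E. (indicator V y :: real) \<in> {t<..1}}) =
      integral {0..1::real} (\<lambda>_. \<xi> V)"
    by (intro integral_spike[of "{1}"]) auto
  then show ?thesis by (simp add: val_integral_def)
qed

section \<open>Step functions and their integrals\<close>

lemma superlevel_add_indicator:
  fixes w :: real
  assumes "0 \<le> w"
  shows "{x \<in> D. t < w * indicator B x + c x} = {x \<in> D. t < c x} \<union> ({x \<in> D. t - w < c x} \<inter> B)"
  using assms by (auto simp: indicator_def split: if_splits)

lemma scott_open_step:
  fixes w :: "'i \<Rightarrow> real"
  assumes "finite I" "\<And>i. i \<in> I \<Longrightarrow> scott_open D (G i)" "\<And>i. i \<in> I \<Longrightarrow> 0 \<le> w i"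
  shows "scott_open D {x \<in> D. t < (\<Sum>i\<in>I. w i * indicator (G i) x)}"
  using assms
proof (induction I arbitrary: t rule: finite_induct)
  case empty
  then show ?case by (cases "t < 0") (simp_all add: scott_open_empty scott_open_space)
next
  case (insert j I)
  let ?c = "\<lambda>x. \<Sum>i\<in>I. w i * indicator (G i) x"
  have "{x \<in> D. t < (\<Sum>i\<in>insert j I. w i * indicator (G i) x)} =
      {x \<in> D. t < ?c x} \<union> ({x \<in> D. t - w j < ?c x} \<inter> G j)"
    unfolding sum.insert[OF insert.hyps] by (rule superlevel_add_indicator) (simp add: insert.prems)
  then show ?case
    using insert by (auto intro!: scott_open_Un scott_open_Int)
qed

text \<open>Linearity on step functions, obtained by adding one indicator at a time: modularity
  separates the new term, and shifting the threshold by \<open>w j\<close> gives its contribution.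
  The upper limit \<open>T\<close>, rather than 1, makes room for weights with sum above 1.\<close>

lemma integral_step_superlevel:
  fixes w :: "'i \<Rightarrow> real"
  assumes "finite I" "\<nu> \<in> valuations D" "\<And>i. i \<in> I \<Longrightarrow> scott_open D (G i)"
    "\<And>i. i \<in> I \<Longrightarrow> 0 \<le> w i" "(\<Sum>i\<in>I. w i) \<le> T"
  shows "integral {0..T} (\<lambda>t. \<nu> {x \<in> D. t < (\<Sum>i\<in>I. w i * indicator (G i) x)}) =
    (\<Sum>i\<in>I. w i * \<nu> (G i))"
  using assms
proof (induction I rule: finite_induct)
  case empty
  have "integral {0..T} (\<lambda>t. \<nu> {x \<in> D. t < 0}) = integral {0..T} (\<lambda>_. 0)"
    by (rule integral_cong) (use valuationsD(2)[OF empty.prems(1)] in auto)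
  then show ?case by simp
next
  case (insert j I)
  note \<nu> = insert.prems(1)
  define c where "c x = (\<Sum>i\<in>I. w i * indicator (G i) x)" for x
  define h where "h t = \<nu> {x \<in> D. t < c x}" for t
  define k where "k t = \<nu> ({x \<in> D. t < c x} \<inter> G j)" for t
  have w: "0 \<le> w j" "0 \<le> (\<Sum>i\<in>I. w i)" "w j + (\<Sum>i\<in>I. w i) \<le> T"
    using insert.prems insert.hyps by (auto intro: sum_nonneg)
  have opc: "scott_open D {x \<in> D. t < c x}" for t
    unfolding c_def using insert by (intro scott_open_step) auto
  have opj: "scott_open D (G j)"
    using insert.prems by auto
  have anti: "antimono h" "antimono k"
    unfolding h_def k_def
    by (auto simp: antimono_def intro!: valuationsD(5)[OF \<nu>] scott_open_Int opc opj)
  have ck: "0 \<le> c x" "c x \<le> (\<Sum>i\<in>I. w i)" for x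
    unfolding c_def using insert.prems(3)
    by (auto intro!: sum_nonneg sum_mono simp: indicator_def)
  \<comment> \<open>\<open>?A\<close> and \<open>?B\<close> meet in \<open>?A \<inter> G j\<close>
    as \<open>w j \<ge> 0\<close>; modularity thus yields \<open>k\<close> at the two thresholds
    \<open>t - w j\<close> and \<open>t\<close>.\<close>
  have split: "\<nu> {x \<in> D. t < (\<Sum>i\<in>insert j I. w i * indicator (G i) x)} = h t + (k (t - w j) - k t)" for t
  proof -
    let ?A = "{x \<in> D. t < c x}" and ?B = "{x \<in> D. t - w j < c x} \<inter> G j"
    have "{x \<in> D. t < (\<Sum>i\<in>insert j I. w i * indicator (G i) x)} = ?A \<union> ?B"
      unfolding sum.insert[OF insert.hyps] c_def by (rule superlevel_add_indicator[OF w(1)])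
    moreover have "?A \<inter> ?B = ?A \<inter> G j"
      using w(1) by auto
    moreover have "\<nu> ?A + \<nu> ?B = \<nu> (?A \<union> ?B) + \<nu> (?A \<inter> ?B)"
      by (intro valuationsD(6)[OF \<nu>] scott_open_Int opc opj)
    ultimately show ?thesis
      unfolding h_def k_def by simp
  qed
  have shifted: "antimono (\<lambda>t. k (t - w j))"
    using anti(2) by (auto simp: antimono_def)
  have "integral {0..T} (\<lambda>t. h t + (k (t - w j) - k t)) =
      integral {0..T} h + (integral {0..T} (\<lambda>t. k (t - w j)) - integral {0..T} k)"
    using antimono_integrable_on[OF anti(1)] antimono_integrable_on[OF anti(2)]
      antimono_integrable_on[OF shifted]
    by (simp add: integral_add integral_diff integrable_diff)
  also have "integral {0..T} (\<lambda>t. k (t - w j)) - integral {0..T} k = w j * \<nu> (G j)"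
  proof (rule antimono_integral_shift_diff[OF anti(2) w(1)])
    show "w j \<le> T" using w by simp
    show "k t = \<nu> (G j)" if "t < 0" for t
    proof -
      have "{x \<in> D. t < c x} \<inter> G j = G j"
        using that ck(1) scott_openD(1)[OF opj] less_le_trans by blast
      then show ?thesis by (simp add: k_def)
    qed
    show "k t = 0" if "T - w j \<le> t" for t
    proof -
      have "c x \<le> t" for x
        using that ck(2)[of x] w(3) by linarith
      then have "{x \<in> D. t < c x} = {}"
        by (auto simp: not_less)
      then show ?thesis unfolding k_def using valuationsD(2)[OF \<nu>] by (simp only: Int_empty_left)
    qed
  qed
  also have "integral {0..T} h = (\<Sum>i\<in>I. w i * \<nu> (G i))"
    unfolding h_def c_def using insert w by auto
  finally show ?case
    unfolding split by (simp add: insert.hyps)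
qed

text \<open>The values of the step function on \<open>D\<close> are at most 1, while its weights may
  add up to more. It is therefore integrated up to \<open>T\<close>; the part beyond 1 contributes
  nothing, and the rest is compared with \<open>f\<close> level by level.\<close>

lemma step_le_val_integral:
  fixes w :: "'i \<Rightarrow> real"
  assumes I: "finite I" and \<nu>: "\<nu> \<in> valuations D" and f: "scott_lsc D f"
    and op: "\<And>i. i \<in> I \<Longrightarrow> scott_open D (G i)" and w: "\<And>i. i \<in> I \<Longrightarrow> 0 \<le> w i"
    and le: "\<And>x. x \<in> D \<Longrightarrow> (\<Sum>i\<in>I. w i * indicator (G i) x) \<le> f x"
  shows "(\<Sum>i\<in>I. w i * \<nu> (G i)) \<le> val_integral D \<nu> f"
proof -
  define c where "c x = (\<Sum>i\<in>I. w i * indicator (G i) x)" for x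
  define T where "T = max 1 (\<Sum>i\<in>I. w i)"
  have opc: "scott_open D {x \<in> D. t < c x}" for t
    unfolding c_def using I op w by (rule scott_open_step)
  have opf: "scott_open D {x \<in> D. t < f x}" for t
    using f by (simp add: scott_lsc_def)
  have int: "(\<lambda>t. \<nu> {x \<in> D. t < c x}) integrable_on {a..b}" for a b
    by (intro antimono_integrable_on antimono_valuation_superlevel \<nu> opc)
  have c1: "c x \<le> 1" if "x \<in> D" for x
    using le[OF that] f that by (force simp: c_def scott_lsc_def)
  have "(\<Sum>i\<in>I. w i * \<nu> (G i)) = integral {0..T} (\<lambda>t. \<nu> {x \<in> D. t < c x})"
    unfolding c_def by (rule integral_step_superlevel[symmetric]) (use assms in \<open>auto simp: T_def\<close>)
  also have "\<dots> = integral {0..1} (\<lambda>t. \<nu> {x \<in> D. t < c x}) + integral {1..T} (\<lambda>t. \<nu> {x \<in> D. t < c x})"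
    by (rule Henstock_Kurzweil_Integration.integral_combine[symmetric]) (use int in \<open>auto simp: T_def\<close>)
  also have "integral {1..T} (\<lambda>t. \<nu> {x \<in> D. t < c x}) = integral {1..T} (\<lambda>_. 0)"
  proof (rule integral_cong)
    fix t assume "t \<in> {1..T}"
    then have "{x \<in> D. t < c x} = {}"
      using c1 by force
    then show "\<nu> {x \<in> D. t < c x} = 0"
      using valuationsD(2)[OF \<nu>] by (simp only:)
  qed
  also have "integral {0..1} (\<lambda>t. \<nu> {x \<in> D. t < c x}) \<le> integral {0..1} (\<lambda>t. \<nu> {x \<in> D. t < f x})"
  proof (rule integral_le[OF int])
    show "(\<lambda>t. \<nu> {x \<in> D. t < f x}) integrable_on {0..1}"
      by (intro antimono_integrable_on antimono_valuation_superlevel \<nu> opf)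
    show "\<nu> {x \<in> D. t < c x} \<le> \<nu> {x \<in> D. t < f x}" for t
      using le by (intro valuationsD(5)[OF \<nu>] opc opf) (force simp: c_def)
  qed
  finally show ?thesis
    by (simp add: val_integral_scott_lsc[OF f])
qed

section \<open>Sober subspaces of the weak topology\<close>

lemma topspace_weak_topology: "topspace (weak_topology D) = valuations D"
  by (auto simp: weak_topology_def)

text \<open>Thresholds outside \<open>{0..1}\<close> give the empty set or the whole space. Allowing
  them avoids case distinctions for thresholds such as \<open>\<nu>0 V - e / 2\<close>.\<close>

lemma openin_weak_superlevel:
  assumes "scott_open D V"
  shows "openin (weak_topology D) {\<nu> \<in> valuations D. r < \<nu> V}"
proof -
  consider "r < 0" | "r \<in> {0..1}" | "1 < r"
    by fastforce
  then show ?thesis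
  proof cases
    case 1
    then have "{\<nu> \<in> valuations D. r < \<nu> V} = topspace (weak_topology D)"
      using valuationsD(3)[OF _ assms] by (force simp: topspace_weak_topology)
    then show ?thesis by simp
  next
    case 2
    with assms show ?thesis
      unfolding weak_topology_def openin_topology_generated_by_iff
      by (intro generate_topology_on.Basis) (auto simp: openin_scott_topology)
  next
    case 3
    then have "{\<nu> \<in> valuations D. r < \<nu> V} = {}"
      using valuationsD(4)[OF _ assms] by force
    then show ?thesis by (simp only: openin_empty)
  qed
qed

lemma openin_weak_topology_upward:
  assumes "openin (weak_topology D) W" "\<mu> \<in> W" "\<mu> \<in> valuations D" "\<nu> \<in> valuations D"
    and le: "\<And>V. scott_open D V \<Longrightarrow> \<mu> V \<le> \<nu> V"
  shows "\<nu> \<in> W"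
proof -
  from assms(1) have "generate_topology_on (insert (valuations D)
       {{\<nu> \<in> valuations D. \<nu> U > r} | U r. openin (scott_topology D) U \<and> r \<in> {0..1}}) W"
    by (simp add: weak_topology_def openin_topology_generated_by_iff)
  then have "\<mu> \<in> W \<longrightarrow> \<nu> \<in> W"
    by induction (use assms(3,4) le in \<open>auto simp: openin_scott_topology intro: less_le_trans\<close>)
  with assms(2) show ?thesis by simp
qed

lemma t0_space_weak_topology: "t0_space (weak_topology D)"
  unfolding t0_space_def topspace_weak_topology
proof (intro ballI impI)
  have "\<exists>W. openin (weak_topology D) W \<and> \<mu> \<notin> W \<and> \<nu> \<in> W"
    if "\<mu> \<in> valuations D" "\<nu> \<in> valuations D" "scott_open D V" "\<mu> V < \<nu> V" for \<mu> \<nu> V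
    using that openin_weak_superlevel[OF that(3), of "\<mu> V"]
    by (intro exI[of _ "{\<rho> \<in> valuations D. \<mu> V < \<rho> V}"]) auto
  moreover fix \<mu> \<nu> assume *: "\<mu> \<in> valuations D" "\<nu> \<in> valuations D" "\<mu> \<noteq> \<nu>"
  then obtain V where "V \<in> scott_opens D" "\<mu> V \<noteq> \<nu> V"
    using extensionalityI[of \<mu> "scott_opens D" \<nu>] valuationsD(1) by blast
  then have "scott_open D V" "\<mu> V < \<nu> V \<or> \<nu> V < \<mu> V"
    by (auto simp: openin_scott_topology)
  ultimately show "\<exists>W. openin (weak_topology D) W \<and> (\<mu> \<notin> W) = (\<nu> \<in> W)"
    using * by metis
qed

text \<open>Irreducibility in its dual form: if \<open>V \<inter> W\<close> missed \<open>C\<close>,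
  the complements of \<open>V\<close> and \<open>W\<close> would cover \<open>C\<close>, and one of
  them would contain it.\<close>

lemma irreducible_closedin_Int:
  assumes "irreducible_closedin X C" "openin X V" "openin X W" "V \<inter> C \<noteq> {}" "W \<inter> C \<noteq> {}"
  shows "V \<inter> W \<inter> C \<noteq> {}"
proof
  assume "V \<inter> W \<inter> C = {}"
  moreover have "C \<subseteq> topspace X"
    using assms(1) by (simp add: irreducible_closedin_def closedin_subset)
  ultimately have "C \<subseteq> (topspace X - V) \<union> (topspace X - W)"
    by blast
  then have "C \<subseteq> topspace X - V \<or> C \<subseteq> topspace X - W"
    using assms(1-3) unfolding irreducible_closedin_def by blast
  with assms(4,5) show False by blast
qed

text \<open>The witness is the pointwise supremum of \<open>C\<close>. By irreducibility,
  approximations of it on two open sets are realised by a single member of \<open>C\<close>, which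
  gives modularity; continuity is inherited from the members of \<open>C\<close>. Whether the
  supremum lies in \<open>S\<close> is left open here.\<close>

lemma irreducible_closedin_weak_sup:
  assumes S: "S \<subseteq> valuations D" and C: "irreducible_closedin (subtopology (weak_topology D) S) C"
  obtains \<nu>0 where "\<nu>0 \<in> valuations D" "\<And>\<nu> V. \<nu> \<in> C \<Longrightarrow> scott_open D V \<Longrightarrow> \<nu> V \<le> \<nu>0 V"
    "\<And>W. openin (weak_topology D) W \<Longrightarrow> \<nu>0 \<in> W \<Longrightarrow> W \<inter> C \<noteq> {}"
proof -
  let ?X = "subtopology (weak_topology D) S"
  have CS: "C \<subseteq> S" and Cne: "C \<noteq> {}"
    using C closedin_subset[of ?X C] by (auto simp: irreducible_closedin_def)
  then have CV: "\<nu> \<in> valuations D" if "\<nu> \<in> C" for \<nu>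
    using S that by blast
  have int: "V \<inter> W \<inter> C \<noteq> {}"
    if "openin (weak_topology D) V" "openin (weak_topology D) W" "V \<inter> C \<noteq> {}" "W \<inter> C \<noteq> {}" for V W
    using irreducible_closedin_Int[OF C, of "S \<inter> V" "S \<inter> W"] that CS
    by (auto simp: openin_subtopology_Int2 Int_commute)
  define \<nu>0 where "\<nu>0 = (\<lambda>V\<in>scott_opens D. SUP \<nu>\<in>C. \<nu> V)"
  have \<nu>0: "\<nu>0 V = (SUP \<nu>\<in>C. \<nu> V)" if "scott_open D V" for V
    using that by (simp add: \<nu>0_def openin_scott_topology)
  have bdd: "bdd_above ((\<lambda>\<nu>. \<nu> V) ` C)" if "scott_open D V" for V
    using valuationsD(4)[OF CV that] by (intro bdd_aboveI[of _ 1]) auto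
  have upper: "\<nu> V \<le> \<nu>0 V" if "\<nu> \<in> C" "scott_open D V" for \<nu> V
    unfolding \<nu>0[OF that(2)] by (rule cSUP_upper[OF that(1) bdd[OF that(2)]])
  have less: "\<exists>\<nu>\<in>C. t < \<nu> V" if "scott_open D V" "t < \<nu>0 V" for V t
    using that less_cSUP_iff[OF Cne bdd[OF that(1)]] by (simp add: \<nu>0)
  have less2: "\<exists>\<nu>\<in>C. s < \<nu> V \<and> t < \<nu> W"
    if VW: "scott_open D V" "scott_open D W" "s < \<nu>0 V" "t < \<nu>0 W" for V W s t
  proof -
    let ?P = "{\<nu> \<in> valuations D. s < \<nu> V}" and ?Q = "{\<nu> \<in> valuations D. t < \<nu> W}"
    have "?P \<inter> C \<noteq> {}" "?Q \<inter> C \<noteq> {}"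
      using less[OF VW(1,3)] less[OF VW(2,4)] CV by auto
    then have "?P \<inter> ?Q \<inter> C \<noteq> {}"
      by (intro int openin_weak_superlevel VW)
    then show ?thesis by blast
  qed
  \<comment> \<open>The two inequalities of modularity are instances of this claim with the sides
    exchanged.\<close>
  have half: "\<nu>0 V + \<nu>0 W \<le> \<nu>0 V' + \<nu>0 W'"
    if op: "scott_open D V" "scott_open D W" "scott_open D V'" "scott_open D W'"
      and eq: "\<And>\<nu>. \<nu> \<in> C \<Longrightarrow> \<nu> V + \<nu> W = \<nu> V' + \<nu> W'" for V W V' W'
  proof (rule field_le_epsilon)
    fix e :: real assume "0 < e"
    then obtain \<nu> where \<nu>: "\<nu> \<in> C" "\<nu>0 V - e / 2 < \<nu> V" "\<nu>0 W - e / 2 < \<nu> W"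
      using less2[OF op(1,2), of "\<nu>0 V - e / 2" "\<nu>0 W - e / 2"] by auto
    then have "\<nu>0 V + \<nu>0 W - e \<le> \<nu> V' + \<nu> W'"
      using eq[of \<nu>] by simp
    also have "\<dots> \<le> \<nu>0 V' + \<nu>0 W'"
      using upper \<nu>(1) op by (intro add_mono) auto
    finally show "\<nu>0 V + \<nu>0 W \<le> \<nu>0 V' + \<nu>0 W' + e" by simp
  qed
  have val: "\<nu>0 \<in> valuations D"
  proof (rule valuationsI)
    show "\<nu>0 \<in> extensional (scott_opens D)"
      by (simp add: \<nu>0_def)
    have "(SUP \<nu>\<in>C. \<nu> {}) = (SUP \<nu>\<in>C. 0)"
      using valuationsD(2)[OF CV] by (intro SUP_cong) auto
    then show "\<nu>0 {} = 0"
      using Cne by (simp add: \<nu>0[OF scott_open_empty])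
    show "0 \<le> \<nu>0 V \<and> \<nu>0 V \<le> 1" if V: "scott_open D V" for V
    proof
      obtain \<nu> where "\<nu> \<in> C" using Cne by blast
      then show "0 \<le> \<nu>0 V"
        using upper[OF _ V] valuationsD(3)[OF CV V] by (meson order_trans)
      show "\<nu>0 V \<le> 1"
        unfolding \<nu>0[OF V] by (rule cSUP_least[OF Cne valuationsD(4)[OF CV V]])
    qed
    show "\<nu>0 V \<le> \<nu>0 W" if "scott_open D V" "scott_open D W" "V \<subseteq> W" for V W
      unfolding \<nu>0[OF that(1)]
      using upper[OF _ that(2)] valuationsD(5)[OF CV that] by (intro cSUP_least[OF Cne]) (meson order_trans)
    show "\<nu>0 V + \<nu>0 W = \<nu>0 (V \<union> W) + \<nu>0 (V \<inter> W)" if "scott_open D V" "scott_open D W" for V W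
      using valuationsD(6)[OF CV that] that
      by (intro antisym half) (auto intro: scott_open_Un scott_open_Int)
    show "\<exists>V\<in>K. t < \<nu>0 V" if K0: "K \<noteq> {}" and K: "\<And>V. V \<in> K \<Longrightarrow> scott_open D V"
      and dir: "\<And>V W. V \<in> K \<Longrightarrow> W \<in> K \<Longrightarrow> \<exists>Z\<in>K. V \<union> W \<subseteq> Z" and t: "t < \<nu>0 (\<Union>K)" for K t
    proof -
      obtain \<nu> where \<nu>: "\<nu> \<in> C" "t < \<nu> (\<Union>K)"
        using less[OF scott_open_Union[of K D, OF K] t] by blast
      then obtain V where "V \<in> K" "t < \<nu> V"
        using valuation_less_Union[OF CV[OF \<nu>(1)] K0 K dir] by blast
      with upper[OF \<nu>(1) K] show ?thesis by force
    qed
  qed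
  have "W \<inter> C \<noteq> {}" if "openin (weak_topology D) W" "\<nu>0 \<in> W" for W
  proof -
    let ?B = "insert (valuations D)
       {{\<nu> \<in> valuations D. \<nu> U > r} | U r. openin (scott_topology D) U \<and> r \<in> {0..1}}"
    have "generate_topology_on ?B W"
      using that(1) by (simp add: weak_topology_def openin_topology_generated_by_iff)
    then have "\<nu>0 \<in> W \<longrightarrow> W \<inter> C \<noteq> {}"
    proof induction
      case (Int a b)
      then have "openin (weak_topology D) a" "openin (weak_topology D) b"
        by (simp_all add: weak_topology_def openin_topology_generated_by_iff)
      with Int.IH int show ?case by blast
    next
      case (Basis s)
      then consider "s = valuations D" | V r where "scott_open D V" "s = {\<nu> \<in> valuations D. r < \<nu> V}"
        by (auto simp: openin_scott_topology)
      then show ?case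
      proof cases
        case 1
        then show ?thesis using Cne CV by blast
      next
        case (2 V r)
        then show ?thesis using less[OF 2(1), of r] CV by auto
      qed
    qed blast+
    with that(2) show ?thesis by simp
  qed
  with val upper show thesis by (rule that)
qed

text \<open>Once the supremum \<open>\<nu>0\<close> of \<open>C\<close> lies in \<open>S\<close>, it
  lies in the relatively closed \<open>C\<close>, since each of its open neighbourhoods meets
  \<open>C\<close>. Its closure is all of \<open>C\<close>, because the members of \<open>C\<close>
  lie below it and open sets are upward closed; uniqueness is the T0 property.\<close>

lemma sober_space_weak_subtopologyI:
  assumes S: "S \<subseteq> valuations D"
    and closed: "\<And>C \<nu>0. C \<subseteq> S \<Longrightarrow> \<nu>0 \<in> valuations D \<Longrightarrow>
      (\<And>\<nu> V. \<nu> \<in> C \<Longrightarrow> scott_open D V \<Longrightarrow> \<nu> V \<le> \<nu>0 V) \<Longrightarrow>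
      (\<And>W. openin (weak_topology D) W \<Longrightarrow> \<nu>0 \<in> W \<Longrightarrow> W \<inter> C \<noteq> {}) \<Longrightarrow> \<nu>0 \<in> S"
  shows "sober_space (subtopology (weak_topology D) S)"
proof -
  let ?X = "subtopology (weak_topology D) S"
  have t0: "t0_space ?X"
    by (simp add: t0_space_subtopology t0_space_weak_topology)
  have top: "topspace ?X = S"
    using S by (auto simp: topspace_weak_topology)
  have "\<exists>!\<nu>. \<nu> \<in> topspace ?X \<and> C = ?X closure_of {\<nu>}" if C: "irreducible_closedin ?X C" for C
  proof -
    obtain \<nu>0 where \<nu>0: "\<nu>0 \<in> valuations D" "\<And>\<nu> V. \<nu> \<in> C \<Longrightarrow> scott_open D V \<Longrightarrow> \<nu> V \<le> \<nu>0 V"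
      "\<And>W. openin (weak_topology D) W \<Longrightarrow> \<nu>0 \<in> W \<Longrightarrow> W \<inter> C \<noteq> {}"
      using irreducible_closedin_weak_sup[OF S C] by blast
    have cl: "closedin ?X C" and CS: "C \<subseteq> S"
      using C closedin_subset[of ?X C] top by (auto simp: irreducible_closedin_def)
    have "\<nu>0 \<in> S"
      using CS \<nu>0 by (rule closed)
    moreover have "\<nu>0 \<in> C"
    proof (rule ccontr)
      assume "\<nu>0 \<notin> C"
      moreover have "openin ?X (S - C)"
        using cl top by (metis closedin_def)
      then obtain W where "openin (weak_topology D) W" "S - C = W \<inter> S"
        by (auto simp: openin_subtopology)
      ultimately show False
        using \<nu>0(3)[of W] \<open>\<nu>0 \<in> S\<close> CS by blast
    qed
    have "C = ?X closure_of {\<nu>0}"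
    proof
      show "?X closure_of {\<nu>0} \<subseteq> C"
        using cl \<open>\<nu>0 \<in> C\<close> by (intro closure_of_minimal) auto
      show "C \<subseteq> ?X closure_of {\<nu>0}"
      proof
        fix \<nu> assume \<nu>: "\<nu> \<in> C"
        have "\<nu>0 \<in> T" if T: "openin ?X T" "\<nu> \<in> T" for T
        proof -
          from T(1) obtain W where W: "openin (weak_topology D) W" "T = W \<inter> S"
            unfolding openin_subtopology by (elim exE conjE)
          have "\<nu>0 \<in> W"
          proof (rule openin_weak_topology_upward[OF W(1)])
            show "\<nu> \<in> W" "\<nu> \<in> valuations D"
              using T(2) W(2) S by auto
          qed (use \<nu>0 \<nu> in auto)
          with W(2) \<open>\<nu>0 \<in> S\<close> show ?thesis by simp
        qed
        then show "\<nu> \<in> ?X closure_of {\<nu>0}"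
          using \<nu> CS top by (auto simp: in_closure_of)
      qed
    qed
    moreover have "\<mu> = \<nu>0" if "\<mu> \<in> topspace ?X" "C = ?X closure_of {\<mu>}" for \<mu>
      using t0 that \<open>\<nu>0 \<in> S\<close> \<open>C = ?X closure_of {\<nu>0}\<close> top unfolding t0_space_closure_of_sing by metis
    ultimately show ?thesis
      using top by blast
  qed
  with t0 show ?thesis
    by (simp add: sober_space_def)
qed

section \<open>Point-continuous valuations\<close>

text \<open>\<open>F\<close> certifies the bound \<open>t\<close> on all of its open neighbourhoods.
  No particular \<open>V\<close> enters, so the certificate passes to pointwise larger valuations
  and applies to any open set around \<open>F\<close>.\<close>

definition point_bound :: "'a::order set \<Rightarrow> ('a set \<Rightarrow> real) \<Rightarrow> real \<Rightarrow> 'a set \<Rightarrow> bool" where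
  "point_bound D \<nu> t F \<longleftrightarrow> finite F \<and> F \<subseteq> D \<and> (\<forall>V. scott_open D V \<and> F \<subseteq> V \<longrightarrow> t < \<nu> V)"

text \<open>This is Heckmann's notion of a point-continuous valuation.\<close>

definition point_continuous :: "'a::order set \<Rightarrow> ('a set \<Rightarrow> real) \<Rightarrow> bool" where
  "point_continuous D \<nu> \<longleftrightarrow> (\<forall>V t. scott_open D V \<and> t < \<nu> V \<longrightarrow> (\<exists>F\<subseteq>V. point_bound D \<nu> t F))"

section \<open>Decomposition into atoms, and open cylinders\<close>

lemma scott_open_Int_INT:
  assumes "finite A" "scott_open E V" "\<And>x. x \<in> A \<Longrightarrow> scott_open E (B x)"
  shows "scott_open E (V \<inter> (\<Inter>x\<in>A. B x))"
  using assms
proof (induction A rule: finite_induct)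
  case (insert a A)
  then have "scott_open E (V \<inter> (\<Inter>x\<in>A. B x) \<inter> B a)"
    by (intro scott_open_Int[of E "V \<inter> (\<Inter>x\<in>A. B x)"]) auto
  moreover have "V \<inter> (\<Inter>x\<in>A. B x) \<inter> B a = V \<inter> (\<Inter>x\<in>insert a A. B x)"
    by auto
  ultimately show ?case by simp
qed simp

lemma scott_open_UN: "(\<And>x. x \<in> A \<Longrightarrow> scott_open E (B x)) \<Longrightarrow> scott_open E (\<Union>x\<in>A. B x)"
  by (rule scott_open_Union) auto

text \<open>Each summand is the mass of an atom: the points of \<open>V\<close> lying in
  \<open>B x\<close> for all \<open>x \<in> A\<close> and for no \<open>x \<in> H - A\<close>. Atoms
  need not be open, hence the difference of two open masses. A new \<open>h\<close> cuts every atom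
  in two, and modularity shows that the masses of the halves add up.\<close>

lemma valuation_sum_atoms:
  assumes \<xi>: "\<xi> \<in> valuations E" and "finite H" "scott_open E V" "\<And>x. x \<in> H \<Longrightarrow> scott_open E (B x)"
  shows "(\<Sum>A\<in>Pow H. \<xi> (V \<inter> (\<Inter>x\<in>A. B x)) - \<xi> (V \<inter> (\<Inter>x\<in>A. B x) \<inter> (\<Union>x\<in>H - A. B x))) = \<xi> V"
  using assms(2-)
proof (induction H rule: finite_induct)
  case empty
  then show ?case using valuationsD(2)[OF \<xi>] by simp
next
  case (insert h H)
  let ?T = "\<lambda>H A. \<xi> (V \<inter> (\<Inter>x\<in>A. B x)) - \<xi> (V \<inter> (\<Inter>x\<in>A. B x) \<inter> (\<Union>x\<in>H - A. B x))"
  have split: "?T (insert h H) A + ?T (insert h H) (insert h A) = ?T H A" if A: "A \<in> Pow H" for A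
  proof -
    let ?X = "V \<inter> (\<Inter>x\<in>A. B x)" and ?K = "\<Union>x\<in>H - A. B x"
    have fin: "finite A" using A insert.hyps(1) finite_subset by blast
    have X: "scott_open E ?X"
      using A insert.prems fin by (intro scott_open_Int_INT) auto
    have K: "scott_open E ?K"
      using insert.prems by (intro scott_open_UN) auto
    have h: "scott_open E (B h)"
      using insert.prems by simp
    have hA: "h \<notin> A" using A insert.hyps by auto
    then have "insert h H - A = insert h (H - A)" "insert h H - insert h A = H - A"
      using insert.hyps by auto
    moreover have "\<xi> (?X \<inter> ?K) + \<xi> (?X \<inter> B h) = \<xi> ((?X \<inter> ?K) \<union> (?X \<inter> B h)) + \<xi> ((?X \<inter> ?K) \<inter> (?X \<inter> B h))"
      by (intro valuationsD(6)[OF \<xi>] scott_open_Int X K h)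
    moreover have "V \<inter> (\<Inter>x\<in>insert h A. B x) = ?X \<inter> B h"
      "?X \<inter> B h \<inter> ?K = (?X \<inter> ?K) \<inter> (?X \<inter> B h)"
      "?X \<inter> (\<Union>x\<in>insert h (H - A). B x) = (?X \<inter> ?K) \<union> (?X \<inter> B h)"
      by auto
    ultimately show ?thesis by simp
  qed
  have "(\<Sum>A\<in>Pow (insert h H). ?T (insert h H) A) =
      (\<Sum>A\<in>Pow H. ?T (insert h H) A) + (\<Sum>A\<in>insert h ` Pow H. ?T (insert h H) A)"
    unfolding Pow_insert using insert.hyps by (intro sum.union_disjoint) auto
  also have "(\<Sum>A\<in>insert h ` Pow H. ?T (insert h H) A) = (\<Sum>A\<in>Pow H. ?T (insert h H) (insert h A))"
    using insert.hyps by (subst sum.reindex) (auto simp: inj_on_def)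
  also have "(\<Sum>A\<in>Pow H. ?T (insert h H) A) + \<dots> = (\<Sum>A\<in>Pow H. ?T H A)"
    unfolding sum.distrib[symmetric] by (rule sum.cong[OF refl split])
  also have "\<dots> = \<xi> V"
    using insert by auto
  finally show ?case .
qed

lemma scott_open_Times:
  fixes D :: "'a::order set" and E :: "'b::order set"
  assumes V: "scott_open E V"
  shows "scott_open (D \<times> E) (D \<times> V)"
  unfolding scott_open_def
proof (intro conjI ballI allI impI)
  show "D \<times> V \<subseteq> D \<times> E"
    using scott_openD(1)[OF V] by auto
next
  fix p q assume "p \<in> D \<times> V" "q \<in> D \<times> E" "p \<le> q"
  then show "q \<in> D \<times> V"
    using scott_openD(2)[OF V, of "snd p" "snd q"] by (auto simp: less_eq_prod_def)
next
  fix S p assume S: "S \<subseteq> D \<times> E" and p: "p \<in> D \<times> V" and *: "directed_set S \<and> isLub (D \<times> E) S p"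
  have "directed_set (snd ` S)"
    using * unfolding directed_set_def less_eq_prod_def by fastforce
  moreover have "isLub E (snd ` S) (snd p)"
    unfolding isLub_iff
  proof (intro conjI ballI impI)
    show "snd p \<in> E" "\<And>s. s \<in> snd ` S \<Longrightarrow> s \<le> snd p"
      using * unfolding isLub_iff less_eq_prod_def by auto
    fix z assume "z \<in> E" "\<forall>s\<in>snd ` S. s \<le> z"
    \<comment> \<open>A bound \<open>z\<close> for the second coordinates becomes a bound for
      \<open>S\<close> in the product when paired with \<open>fst p\<close>.\<close>
    then have "p \<le> (fst p, z)"
      using * p unfolding isLub_iff by (auto simp: less_eq_prod_def)
    then show "snd p \<le> z" by (simp add: less_eq_prod_def)
  qed
  ultimately have "snd ` S \<inter> V \<noteq> {}"
    using S p by (intro scott_openD(3)[OF V]) auto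
  then show "S \<inter> D \<times> V \<noteq> {}"
    using S by auto
qed

section \<open>The upper bound for point-continuous valuations\<close>

lemma sum_indicator_card:
  assumes "finite A" "B \<subseteq> A"
  shows "(\<Sum>i\<in>A. indicator B i :: real) = card B"
  using assms by (simp add: indicator_def sum.If_cases Int_absorb1)

text \<open>For \<open>i \<ge> 1\<close> the condition forces \<open>i\<close> to be at most the
  floor of \<open>n * v\<close>; starting at 0 could admit one index too many.\<close>

lemma card_less_mult_le:
  fixes n :: nat and v :: real
  assumes "0 < n" "0 \<le> v"
  shows "real (card {i \<in> {1..n}. real i / n < v}) / n \<le> v"
proof -
  have "{i \<in> {1..n}. real i / n < v} \<subseteq> {1..nat \<lfloor>n * v\<rfloor>}"
    using assms by (auto simp: le_nat_floor divide_less_eq mult.commute)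
  from card_mono[OF finite_atLeastAtMost this] have "card {i \<in> {1..n}. real i / n < v} \<le> nat \<lfloor>n * v\<rfloor>"
    by simp
  also have "real \<dots> \<le> n * v"
    using assms by (simp add: of_nat_floor)
  finally show ?thesis
    using assms by (simp add: divide_le_eq mult.commute)
qed

text \<open>The section at \<open>y\<close> has mass above \<open>t\<close> exactly when it contains
  some certificate \<open>F\<close>, that is, when \<open>y\<close> lies in the sections of
  \<open>U\<close> at all points of \<open>F\<close>. Finite unions of these open intersections form
  a directed family, so one of them exhausts the mass up to \<open>e\<close>.\<close>

lemma point_continuous_approx:
  fixes D :: "'a::order set" and E :: "'b::order set"
  assumes U: "scott_open (D \<times> E) U" and \<nu>: "\<nu> \<in> valuations D" "point_continuous D \<nu>"
    and \<xi>: "\<xi> \<in> valuations E" and "0 < e"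
  shows "\<exists>\<F>. finite \<F> \<and> (\<forall>F\<in>\<F>. point_bound D \<nu> t F) \<and>
    \<xi> {y \<in> E. t < \<nu> (U\<inverse> `` {y})} - e < \<xi> (\<Union>F\<in>\<F>. E \<inter> (\<Inter>x\<in>F. U `` {x}))"
proof -
  define I where "I F = E \<inter> (\<Inter>x\<in>F. U `` {x})" for F
  define K where "K = {\<Union>(I ` \<F>) | \<F>. finite \<F> \<and> (\<forall>F\<in>\<F>. point_bound D \<nu> t F)}"
  have opI: "scott_open E (I F)" if "point_bound D \<nu> t F" for F
    using that unfolding I_def point_bound_def
    by (intro scott_open_Int_INT scott_open_space scott_open_Image[OF U]) auto
  have "{y \<in> E. t < \<nu> (U\<inverse> `` {y})} = \<Union>K"
  proof (intro equalityI subsetI)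
    fix y assume y: "y \<in> {y \<in> E. t < \<nu> (U\<inverse> `` {y})}"
    then have "scott_open D (U\<inverse> `` {y})"
      by (intro scott_open_Image[OF scott_open_converse[OF U]]) auto
    then obtain F where F: "F \<subseteq> U\<inverse> `` {y}" "point_bound D \<nu> t F"
      using \<nu>(2) y unfolding point_continuous_def by blast
    then have "y \<in> \<Union>(I ` {F})"
      using y by (auto simp: I_def)
    moreover have "\<Union>(I ` {F}) \<in> K"
      unfolding K_def using F(2) by blast
    ultimately show "y \<in> \<Union>K" by blast
  next
    fix y assume "y \<in> \<Union>K"
    then obtain F where F: "point_bound D \<nu> t F" "y \<in> I F"
      unfolding K_def by blast
    then have "y \<in> E" "F \<subseteq> U\<inverse> `` {y}"
      by (auto simp: I_def)
    moreover from this have "scott_open D (U\<inverse> `` {y})"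
      by (intro scott_open_Image[OF scott_open_converse[OF U]])
    ultimately show "y \<in> {y \<in> E. t < \<nu> (U\<inverse> `` {y})}"
      using F(1) unfolding point_bound_def by blast
  qed
  moreover have "\<exists>V\<in>K. \<xi> (\<Union>K) - e < \<xi> V"
  proof (rule valuation_less_Union[OF \<xi>])
    show "K \<noteq> {}" unfolding K_def by blast
    show "scott_open E V" if "V \<in> K" for V
      using that opI unfolding K_def by (auto intro!: scott_open_UN)
    show "\<exists>Z\<in>K. V \<union> W \<subseteq> Z" if VW: "V \<in> K" "W \<in> K" for V W
    proof -
      from VW(1) obtain \<F> where F: "V = \<Union>(I ` \<F>)" "finite \<F>" "\<forall>F\<in>\<F>. point_bound D \<nu> t F"
        unfolding K_def by blast
      from VW(2) obtain \<G> where G: "W = \<Union>(I ` \<G>)" "finite \<G>" "\<forall>F\<in>\<G>. point_bound D \<nu> t F"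
        unfolding K_def by blast
      have "\<Union>(I ` (\<F> \<union> \<G>)) \<in> K"
        unfolding K_def using F(2,3) G(2,3) by blast
      then show ?thesis
        unfolding F(1) G(1) by (rule bexI[rotated]) auto
    qed
  qed (use \<open>0 < e\<close> in simp)
  ultimately show ?thesis
    unfolding K_def I_def by auto
qed

text \<open>
  On the finite set \<open>H\<close> the sections \<open>U\<^sub>x\<close> generate finitely many atoms \<open>E\<^sub>A\<close>
  (\<open>A \<subseteq> H\<close>, the \<open>y\<close> lying in exactly those \<open>U\<^sub>x\<close> with \<open>x \<in> A\<close>), of mass \<open>p A\<close>. The function
  \<open>\<phi> A\<close>, sending \<open>x\<close> to the mass of \<open>U\<^sub>x \<inter> E\<^sub>A\<close>, is lower semicontinuous and equals \<open>p A\<close> on \<open>A\<close>, so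
  its superlevel sets are open neighbourhoods of \<open>A\<close>, whose \<open>\<nu>\<close>-mass is bounded below by
  point-continuity.
\<close>

lemma point_continuous_integral_le:
  fixes D :: "'a::order set" and E :: "'b::order set"
  assumes U: "scott_open (D \<times> E) U" and \<nu>: "\<nu> \<in> valuations D" "point_continuous D \<nu>"
    and \<xi>: "\<xi> \<in> valuations E"
  shows "val_integral E \<xi> (\<lambda>y. \<nu> (U\<inverse> `` {y})) \<le> val_integral D \<nu> (\<lambda>x. \<xi> (U `` {x}))"
    (is "?G \<le> ?F")
proof (rule field_le_epsilon)
  fix d :: real assume "0 < d"
  \<comment> \<open>Three losses of at most \<open>e\<close> each will add up: \<open>1 / n\<close>
    from discretising, the approximation by certificates, and the factor \<open>1 - e\<close>. The
    bound 1/2 keeps that factor positive.\<close>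
  define e where "e = min (1/2) (d / 3)"
  have e: "0 < e" "e < 1" "3 * e \<le> d"
    using \<open>0 < d\<close> by (auto simp: e_def)
  obtain n :: nat where n: "0 < n" "1 / n < e"
    using e(1) by (metis nat_approx_posE zero_less_Suc)
  define I where "I A = E \<inter> (\<Inter>x\<in>A. U `` {x})" for A
  have "\<forall>i. \<exists>\<F>. finite \<F> \<and> (\<forall>F\<in>\<F>. point_bound D \<nu> (real i / n) F) \<and>
      \<xi> {y \<in> E. real i / n < \<nu> (U\<inverse> `` {y})} - e < \<xi> (\<Union>(I ` \<F>))"
    unfolding I_def using point_continuous_approx[OF U \<nu> \<xi> e(1)] by blast
  from choice[OF this] obtain \<F> where \<F>: "\<And>i. finite (\<F> i)" "\<And>i F. F \<in> \<F> i \<Longrightarrow> point_bound D \<nu> (real i / n) F"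
    "\<And>i. \<xi> {y \<in> E. real i / n < \<nu> (U\<inverse> `` {y})} - e < \<xi> (\<Union>(I ` \<F> i))"
    by blast
  define H where "H = (\<Union>i\<in>{1..n}. \<Union>(\<F> i))"
  have H: "finite H" "H \<subseteq> D"
    using \<F>(1,2) unfolding H_def point_bound_def by auto
  have opU: "scott_open E (U `` {x})" if "x \<in> D" for x
    by (rule scott_open_Image[OF U that])
  define K where "K A = (\<Union>x\<in>H - A. U `` {x})" for A
  define p where "p A = \<xi> (I A) - \<xi> (I A \<inter> K A)" for A
  define \<phi> where "\<phi> A x = \<xi> (U `` {x} \<inter> I A) - \<xi> (U `` {x} \<inter> I A \<inter> K A)" for A x
  \<comment> \<open>Lowering the threshold by the factor \<open>1 - e\<close> makes the inequality
    strict on \<open>A\<close> when \<open>p A > 0\<close>.\<close>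
  define N where "N A = {x \<in> D. (1 - e) * p A < \<phi> A x}" for A
  have opI: "scott_open E (I A)" if "finite A" "A \<subseteq> D" for A
    using that opU unfolding I_def by (intro scott_open_Int_INT scott_open_space) auto
  have opIA: "scott_open E (I A)" if "A \<in> Pow H" for A
    using that H finite_subset by (intro opI) auto
  have opK: "scott_open E (K A)" for A
    unfolding K_def using H(2) opU by (intro scott_open_UN) auto
  have p0: "0 \<le> p A" if "A \<in> Pow H" for A
    unfolding p_def diff_ge_0_iff_ge using that
    by (intro valuationsD(5)[OF \<xi>] scott_open_Int opIA opK) auto
  have \<phi>0: "0 \<le> \<phi> A x" if "A \<in> Pow H" "x \<in> D" for A x
    unfolding \<phi>_def diff_ge_0_iff_ge using that
    by (intro valuationsD(5)[OF \<xi>] scott_open_Int opIA opK opU) auto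
  have atoms: "(\<Sum>A\<in>Pow H. \<xi> (V \<inter> I A) - \<xi> (V \<inter> I A \<inter> K A)) = \<xi> V" if V: "scott_open E V" for V
  proof -
    have VI: "V \<inter> I A = V \<inter> (\<Inter>x\<in>A. U `` {x})" for A
      using scott_openD(1)[OF V] by (auto simp: I_def)
    show ?thesis
      unfolding VI K_def using H(2) opU by (intro valuation_sum_atoms[OF \<xi> H(1) V]) auto
  qed
  have opN: "scott_open D (N A)" if A: "A \<in> Pow H" for A
  proof -
    let ?J = "I A \<inter> K A"
    \<comment> \<open>\<open>\<phi> A x\<close> is a difference of two masses that both depend on
      \<open>x\<close>. Adding the cylinder over \<open>?J\<close> to
      \<open>U \<inter> D \<times> I A\<close> makes the subtracted mass the constant
      \<open>\<xi> ?J\<close>, so a single open subset of the product describes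
      \<open>N A\<close>.\<close>
    let ?U = "(U \<inter> D \<times> I A) \<union> D \<times> ?J"
    have J: "scott_open E ?J"
      by (intro scott_open_Int opIA A opK)
    have "scott_open (D \<times> E) ?U"
      by (intro scott_open_Un scott_open_Int U scott_open_Times opIA A opK)
    then have "scott_open D {x \<in> D. (1 - e) * p A + \<xi> ?J < \<xi> (?U `` {x})}"
      by (rule scott_open_superlevel[OF _ \<xi>])
    moreover have "\<xi> (?U `` {x}) - \<xi> ?J = \<phi> A x" if x: "x \<in> D" for x
    proof -
      have "?U `` {x} = (U `` {x} \<inter> I A) \<union> ?J" "U `` {x} \<inter> I A \<inter> K A = (U `` {x} \<inter> I A) \<inter> ?J"
        using x by auto
      moreover have "\<xi> (U `` {x} \<inter> I A) + \<xi> ?J = \<xi> ((U `` {x} \<inter> I A) \<union> ?J) + \<xi> ((U `` {x} \<inter> I A) \<inter> ?J)"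
        by (intro valuationsD(6)[OF \<xi>] scott_open_Int opU x opIA A J)
      ultimately show ?thesis
        unfolding \<phi>_def by simp
    qed
    then have "{x \<in> D. (1 - e) * p A + \<xi> ?J < \<xi> (?U `` {x})} = N A"
      unfolding N_def by (smt (verit) Collect_cong)
    ultimately show ?thesis by simp
  qed
  define Q where "Q = (\<Sum>A\<in>Pow H. p A * \<nu> (N A))"
  \<comment> \<open>The step function with weights \<open>(1 - e) * p A\<close> on
    \<open>N A\<close> stays below the sum of the \<open>\<phi> A x\<close>, which is the mass of
    the section at \<open>x\<close>.\<close>
  have "(\<Sum>A\<in>Pow H. (1 - e) * p A * \<nu> (N A)) \<le> ?F"
  proof (rule step_le_val_integral[OF _ \<nu>(1) scott_lsc_valuation_Image[OF U \<xi>]])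
    show "finite (Pow H)" using H by simp
    show "0 \<le> (1 - e) * p A" if "A \<in> Pow H" for A
      using p0[OF that] e by simp
    show "(\<Sum>A\<in>Pow H. (1 - e) * p A * indicator (N A) x) \<le> \<xi> (U `` {x})" if x: "x \<in> D" for x
    proof -
      have "(\<Sum>A\<in>Pow H. (1 - e) * p A * indicator (N A) x) \<le> (\<Sum>A\<in>Pow H. \<phi> A x)"
        using \<phi>0 x by (intro sum_mono) (auto simp: indicator_def N_def)
      then show ?thesis
        unfolding \<phi>_def atoms[OF opU[OF x]] .
    qed
  qed (rule opN)
  then have "(1 - e) * Q \<le> ?F"
    unfolding Q_def by (simp add: sum_distrib_left mult.assoc)
  \<comment> \<open>The atom masses sum to \<open>\<xi> E \<le> 1\<close>, so dropping the factor
    \<open>1 - e\<close> costs at most \<open>e\<close>.\<close>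
  moreover have "Q \<le> 1"
  proof -
    have "Q \<le> (\<Sum>A\<in>Pow H. p A)"
      unfolding Q_def using valuationsD(4)[OF \<nu>(1) opN] p0 by (intro sum_mono mult_left_le) auto
    also have "\<dots> = (\<Sum>A\<in>Pow H. \<xi> (E \<inter> I A) - \<xi> (E \<inter> I A \<inter> K A))"
      by (simp add: p_def I_def)
    also have "\<dots> \<le> 1"
      unfolding atoms[OF scott_open_space] by (rule valuationsD(4)[OF \<xi> scott_open_space])
    finally show ?thesis .
  qed
  then have "e * Q \<le> e"
    using e(1) by (intro mult_left_le) auto
  ultimately have QF: "Q \<le> ?F + e"
    by (simp add: algebra_simps)
  define good where "good A = {i \<in> {1..n}. \<exists>F\<in>\<F> i. F \<subseteq> A}" for A
  \<comment> \<open>An atom lies inside the union when \<open>A\<close> contains some certificate of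
    level \<open>i\<close>, and misses it otherwise. So it contributes \<open>p A\<close> or
    nothing.\<close>
  have B: "\<xi> (\<Union>(I ` \<F> i)) = (\<Sum>A\<in>Pow H. p A * indicator (good A) i)" if i: "i \<in> {1..n}" for i
  proof -
    let ?B = "\<Union>(I ` \<F> i)"
    have opB: "scott_open E ?B"
      using \<F>(2)[of _ i] by (intro scott_open_UN opI) (auto simp: point_bound_def)
    have "\<xi> (?B \<inter> I A) - \<xi> (?B \<inter> I A \<inter> K A) = p A * indicator (good A) i" if A: "A \<in> Pow H" for A
    proof (cases "i \<in> good A")
      case True
      then obtain F where "F \<in> \<F> i" "F \<subseteq> A"
        by (auto simp: good_def)
      then have "?B \<inter> I A = I A"
        by (auto simp: I_def)
      with True show ?thesis by (simp add: p_def)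
    next
      case False
      then have no: "\<not> F \<subseteq> A" if "F \<in> \<F> i" for F
        using that i by (auto simp: good_def)
      have "?B \<inter> I A \<subseteq> K A"
      proof
        fix y assume "y \<in> ?B \<inter> I A"
        then obtain F where F: "F \<in> \<F> i" "y \<in> I F" by blast
        then obtain x where x: "x \<in> F" "x \<notin> A" using no by blast
        then have "x \<in> H - A" using F(1) i by (auto simp: H_def)
        moreover have "y \<in> U `` {x}" using F(2) x(1) by (auto simp: I_def)
        ultimately show "y \<in> K A" unfolding K_def by blast
      qed
      then have "?B \<inter> I A \<inter> K A = ?B \<inter> I A" by blast
      with False show ?thesis by simp
    qed
    then show ?thesis
      using atoms[OF opB] by simp
  qed
  have good: "p A * (real (card (good A)) / n) \<le> p A * \<nu> (N A)" if A: "A \<in> Pow H" for A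
  proof (cases "p A = 0")
    case False
    with p0[OF A] have pA: "0 < p A" by simp
    have "A \<subseteq> N A"
    proof
      fix x assume x: "x \<in> A"
      then have "U `` {x} \<inter> I A = I A" by (auto simp: I_def)
      then have "\<phi> A x = p A" by (simp add: \<phi>_def p_def)
      then show "x \<in> N A" using x A H(2) pA e by (auto simp: N_def)
    qed
    \<comment> \<open>A certificate of level \<open>i\<close> contained in \<open>A\<close> lies in
      the open set \<open>N A\<close>, whose \<open>\<nu>\<close>-mass therefore exceeds
      \<open>i / n\<close>.\<close>
    then have "good A \<subseteq> {i \<in> {1..n}. real i / n < \<nu> (N A)}"
      using \<F>(2) opN[OF A] unfolding good_def point_bound_def by blast
    then have "card (good A) \<le> card {i \<in> {1..n}. real i / n < \<nu> (N A)}"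
      by (intro card_mono) auto
    then have "real (card (good A)) / n \<le> real (card {i \<in> {1..n}. real i / n < \<nu> (N A)}) / n"
      using n(1) by (intro divide_right_mono) auto
    also have "\<dots> \<le> \<nu> (N A)"
      by (rule card_less_mult_le[OF n(1) valuationsD(3)[OF \<nu>(1) opN[OF A]]])
    finally show ?thesis
      using pA by (intro mult_left_mono) auto
  qed simp
  have "(\<Sum>i=1..n. \<xi> (\<Union>(I ` \<F> i))) = (\<Sum>i=1..n. \<Sum>A\<in>Pow H. p A * indicator (good A) i)"
    by (rule sum.cong[OF refl B])
  also have "\<dots> = (\<Sum>A\<in>Pow H. \<Sum>i=1..n. p A * indicator (good A) i)"
    by (rule sum.swap)
  also have "\<dots> = (\<Sum>A\<in>Pow H. p A * card (good A))"
  proof (rule sum.cong[OF refl])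
    fix A
    have "(\<Sum>i=1..n. indicator (good A) i :: real) = card (good A)"
      by (rule sum_indicator_card) (auto simp: good_def)
    then show "(\<Sum>i=1..n. p A * indicator (good A) i) = p A * card (good A)"
      unfolding sum_distrib_left[symmetric] by simp
  qed
  finally have "(\<Sum>i=1..n. \<xi> (\<Union>(I ` \<F> i))) / n = (\<Sum>A\<in>Pow H. p A * (real (card (good A)) / n))"
    by (simp add: sum_divide_distrib)
  also have "\<dots> \<le> Q"
    unfolding Q_def by (rule sum_mono[OF good])
  finally have BQ: "(\<Sum>i=1..n. \<xi> (\<Union>(I ` \<F> i))) / n \<le> Q" .
  have "?G \<le> 1 / n + (\<Sum>i=1..n. \<xi> {y \<in> E. real i / n < \<nu> (U\<inverse> `` {y})}) / n"
    by (rule val_integral_bounds(2)[OF scott_lsc_valuation_Image[OF scott_open_converse[OF U] \<nu>(1)] \<xi> n(1)])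
  also have "\<dots> \<le> 1 / n + (\<Sum>i=1..n. \<xi> (\<Union>(I ` \<F> i)) + e) / n"
    using \<F>(3) n(1) by (intro add_left_mono divide_right_mono sum_mono) (simp_all add: less_eq_real_def diff_less_eq)
  also have "\<dots> = 1 / n + e + (\<Sum>i=1..n. \<xi> (\<Union>(I ` \<F> i))) / n"
    using n(1) by (simp add: sum.distrib add_divide_distrib)
  also have "\<dots> \<le> ?F + d"
    using BQ QF n(2) e(3) by simp
  finally show "?G \<le> ?F + d" .
qed

section \<open>The sober subspace\<close>

lemma simple_valuation_eq:
  assumes "scott_open D V"
  shows "(\<lambda>U\<in>scott_opens D. \<Sum>i=1..n. r i * dirac D (x i) U) V = (\<Sum>i=1..n. r i * indicator V (x i))"
  using assms by (auto simp: dirac_def openin_scott_topology indicator_def intro!: sum.cong)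

lemma finite_subset_directed_Union:
  assumes "finite A" "A \<subseteq> \<Union>K" "K \<noteq> {}" "\<And>V W. V \<in> K \<Longrightarrow> W \<in> K \<Longrightarrow> \<exists>Z\<in>K. V \<union> W \<subseteq> Z"
  shows "\<exists>V\<in>K. A \<subseteq> V"
  using assms
proof (induction A rule: finite_induct)
  case (insert a A)
  then obtain V W where "V \<in> K" "A \<subseteq> V" "W \<in> K" "a \<in> W" by auto
  then show ?case
    using insert.prems(3)[of V W] by blast
qed auto

lemma simple_valuations_properties:
  assumes "\<mu> \<in> simple_valuations D"
  obtains n :: nat and r x where "\<And>i. i \<in> {1..n} \<Longrightarrow> 0 < r i" "\<And>i. i \<in> {1..n} \<Longrightarrow> x i \<in> D"
    "\<And>V. scott_open D V \<Longrightarrow> \<mu> V = (\<Sum>i=1..n. r i * indicator V (x i))"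
    "\<mu> \<in> valuations D" "point_continuous D \<mu>"
proof -
  obtain n r x where \<mu>: "\<mu> = (\<lambda>U\<in>scott_opens D. \<Sum>i=1..n. r i * dirac D (x i) U)"
    and r: "\<forall>i\<in>{1..n::nat}. r i > 0 \<and> x i \<in> D" "(\<Sum>i=1..n. r i) \<le> 1"
    using assms unfolding simple_valuations_def by blast
  have eq: "\<mu> V = (\<Sum>i=1..n. r i * indicator V (x i))" if "scott_open D V" for V
    unfolding \<mu> by (rule simple_valuation_eq[OF that])
  \<comment> \<open>Only the points \<open>x i\<close> matter, so inclusion on them suffices. This
    yields both Scott-continuity and the certificates, which consist of the points
    \<open>x i\<close> lying in \<open>V\<close>.\<close>
  have le: "\<mu> V \<le> \<mu> W" if "scott_open D V" "scott_open D W" "x ` {1..n} \<inter> V \<subseteq> W" for V W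
    unfolding eq[OF that(1)] eq[OF that(2)]
    using r that(3) by (intro sum_mono mult_left_mono) (auto simp: indicator_def less_imp_le)
  have val: "\<mu> \<in> valuations D"
  proof (rule valuationsI)
    show "\<mu> \<in> extensional (scott_opens D)" by (simp add: \<mu>)
    show "\<mu> {} = 0" by (simp add: eq scott_open_empty)
    show "0 \<le> \<mu> V \<and> \<mu> V \<le> 1" if V: "scott_open D V" for V
    proof
      show "0 \<le> \<mu> V"
        unfolding eq[OF V] using r by (intro sum_nonneg) (auto simp: less_imp_le)
      have "\<mu> V \<le> (\<Sum>i=1..n. r i)"
        unfolding eq[OF V] using r by (intro sum_mono) (auto simp: indicator_def less_imp_le)
      with r(2) show "\<mu> V \<le> 1" by simp
    qed
    show "\<mu> V \<le> \<mu> W" if "scott_open D V" "scott_open D W" "V \<subseteq> W" for V W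
      using that by (intro le) auto
    show "\<mu> V + \<mu> W = \<mu> (V \<union> W) + \<mu> (V \<inter> W)" if "scott_open D V" "scott_open D W" for V W
      unfolding eq[OF that(1)] eq[OF that(2)] eq[OF scott_open_Un[OF that]] eq[OF scott_open_Int[OF that]]
        sum.distrib[symmetric]
      by (rule sum.cong) (auto simp: indicator_def)
    show "\<exists>V\<in>K. t < \<mu> V" if K0: "K \<noteq> {}" and K: "\<And>V. V \<in> K \<Longrightarrow> scott_open D V"
      and dir: "\<And>V W. V \<in> K \<Longrightarrow> W \<in> K \<Longrightarrow> \<exists>Z\<in>K. V \<union> W \<subseteq> Z" and t: "t < \<mu> (\<Union>K)" for K t
    proof -
      obtain V where V: "V \<in> K" "x ` {1..n} \<inter> \<Union>K \<subseteq> V"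
        using finite_subset_directed_Union[of "x ` {1..n} \<inter> \<Union>K" K] K0 dir by blast
      then have "\<mu> (\<Union>K) \<le> \<mu> V"
        using K by (intro le scott_open_Union) auto
      with V(1) t show ?thesis by (intro bexI[of _ V]) auto
    qed
  qed
  have "point_continuous D \<mu>"
    unfolding point_continuous_def
  proof (intro allI impI)
    fix V t assume V: "scott_open D V \<and> t < \<mu> V"
    have "point_bound D \<mu> t (x ` {1..n} \<inter> V)"
      unfolding point_bound_def
      using V r le[of V] by (auto intro: less_le_trans)
    then show "\<exists>F\<subseteq>V. point_bound D \<mu> t F" by blast
  qed
  with val eq r show thesis
    by (intro that[of n r x]) auto
qed

text \<open>Both integrals are compared with the sum of \<open>r j\<close> times the mass of the
  section at \<open>x j\<close>: counting levels bounds the first from above, and in the second the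
  integrand is itself a step function over these sections.\<close>

lemma simple_valuation_integral_le:
  fixes D :: "'a::order set" and E :: "'b::order set"
  assumes U: "scott_open (D \<times> E) U" and \<mu>: "\<mu> \<in> simple_valuations D" and \<xi>: "\<xi> \<in> valuations E"
  shows "val_integral D \<mu> (\<lambda>x. \<xi> (U `` {x})) \<le> val_integral E \<xi> (\<lambda>y. \<mu> (U\<inverse> `` {y}))"
proof -
  obtain m :: nat and r x where r: "\<And>j. j \<in> {1..m} \<Longrightarrow> 0 < r j" and x: "\<And>j. j \<in> {1..m} \<Longrightarrow> x j \<in> D"
    and eq: "\<And>V. scott_open D V \<Longrightarrow> \<mu> V = (\<Sum>j=1..m. r j * indicator V (x j))"
    and val: "\<mu> \<in> valuations D"
    using simple_valuations_properties[OF \<mu>] by metis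
  let ?f = "\<lambda>x. \<xi> (U `` {x})"
  have f0: "0 \<le> ?f (x j)" if "j \<in> {1..m}" for j
    using valuationsD(3)[OF \<xi> scott_open_Image[OF U x[OF that]]] .
  have upper: "val_integral D \<mu> ?f \<le> 1 / n + (\<Sum>j=1..m. r j * ?f (x j))" if n: "0 < n" for n :: nat
  proof -
    have "(\<Sum>i=1..n. \<mu> {z \<in> D. real i / n < ?f z}) =
        (\<Sum>i=1..n. \<Sum>j=1..m. r j * indicator {z \<in> D. real i / n < ?f z} (x j))"
      by (rule sum.cong[OF refl eq[OF scott_open_superlevel[OF U \<xi>]]])
    also have "\<dots> = (\<Sum>j=1..m. \<Sum>i=1..n. r j * indicator {z \<in> D. real i / n < ?f z} (x j))"
      by (rule sum.swap)
    also have "\<dots> = (\<Sum>j=1..m. r j * card {i \<in> {1..n}. real i / n < ?f (x j)})"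
    proof (rule sum.cong[OF refl])
      fix j assume j: "j \<in> {1..m}"
      have "(\<Sum>i=1..n. indicator {z \<in> D. real i / n < ?f z} (x j) :: real) =
          (\<Sum>i=1..n. indicator {i \<in> {1..n}. real i / n < ?f (x j)} i)"
        using x[OF j] by (intro sum.cong) (auto simp: indicator_def)
      also have "\<dots> = card {i \<in> {1..n}. real i / n < ?f (x j)}"
        by (rule sum_indicator_card) auto
      finally show "(\<Sum>i=1..n. r j * indicator {z \<in> D. real i / n < ?f z} (x j)) =
          r j * card {i \<in> {1..n}. real i / n < ?f (x j)}"
        unfolding sum_distrib_left[symmetric] by simp
    qed
    finally have "(\<Sum>i=1..n. \<mu> {z \<in> D. real i / n < ?f z}) / n =
        (\<Sum>j=1..m. r j * (real (card {i \<in> {1..n}. real i / n < ?f (x j)}) / n))"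
      by (simp add: sum_divide_distrib)
    also have "\<dots> \<le> (\<Sum>j=1..m. r j * ?f (x j))"
      using r f0 n by (intro sum_mono mult_left_mono card_less_mult_le) (auto simp: less_imp_le)
    finally show ?thesis
      using val_integral_bounds(2)[OF scott_lsc_valuation_Image[OF U \<xi>] val n] by simp
  qed
  have "val_integral D \<mu> ?f \<le> (\<Sum>j=1..m. r j * ?f (x j))"
  proof (rule field_le_epsilon)
    fix e :: real assume "0 < e"
    then obtain n :: nat where "0 < n" "1 / n < e"
      by (metis nat_approx_posE zero_less_Suc)
    with upper[of n] show "val_integral D \<mu> ?f \<le> (\<Sum>j=1..m. r j * ?f (x j)) + e" by simp
  qed
  also have "\<dots> \<le> val_integral E \<xi> (\<lambda>y. \<mu> (U\<inverse> `` {y}))"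
  proof (rule step_le_val_integral[OF _ \<xi> scott_lsc_valuation_Image[OF scott_open_converse[OF U] val]])
    show "scott_open E (U `` {x j})" if "j \<in> {1..m}" for j
      by (rule scott_open_Image[OF U x[OF that]])
    show "(\<Sum>j=1..m. r j * indicator (U `` {x j}) y) \<le> \<mu> (U\<inverse> `` {y})" if "y \<in> E" for y
      unfolding eq[OF scott_open_Image[OF scott_open_converse[OF U] that]]
      by (rule sum_mono) (auto simp: indicator_def)
  qed (use r in \<open>auto simp: less_imp_le\<close>)
  finally show ?thesis .
qed

text \<open>Lower semicontinuity: up to \<open>1 / n\<close> the integral is a finite combination of
  masses of open sets, and \<open>W\<close> keeps each of these from dropping by
  \<open>e / 2\<close> or more.\<close>

lemma val_integral_weak_approx:
  assumes f: "scott_lsc D f" and \<nu>0: "\<nu>0 \<in> valuations D" and "0 < e"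
  shows "\<exists>W. openin (weak_topology D) W \<and> \<nu>0 \<in> W \<and>
    (\<forall>\<nu>\<in>W. val_integral D \<nu>0 f \<le> val_integral D \<nu> f + e)"
proof -
  obtain n :: nat where n: "0 < n" "1 / n < e / 2"
    using \<open>0 < e\<close> by (metis half_gt_zero nat_approx_posE zero_less_Suc)
  let ?X = "\<lambda>i::nat. {x \<in> D. real i / n < f x}"
  let ?W = "(\<Inter>i\<in>{1..n}. {\<nu> \<in> valuations D. \<nu>0 (?X i) - e / 2 < \<nu> (?X i)}) \<inter> topspace (weak_topology D)"
  have op: "scott_open D (?X i)" for i
    using f by (simp add: scott_lsc_def)
  have "openin (weak_topology D) ?W"
    by (intro openin_INT openin_weak_superlevel op) simp
  moreover have "\<nu>0 \<in> ?W"
    using \<nu>0 \<open>0 < e\<close> by (simp add: topspace_weak_topology)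
  moreover have "val_integral D \<nu>0 f \<le> val_integral D \<nu> f + e" if \<nu>: "\<nu> \<in> ?W" for \<nu>
  proof -
    have "val_integral D \<nu>0 f \<le> 1 / n + (\<Sum>i=1..n. \<nu>0 (?X i)) / n"
      by (rule val_integral_bounds(2)[OF f \<nu>0 n(1)])
    also have "(\<Sum>i=1..n. \<nu>0 (?X i)) / n \<le> (\<Sum>i=1..n. \<nu> (?X i) + e / 2) / n"
      using \<nu> by (intro divide_right_mono sum_mono) (auto simp: less_eq_real_def diff_less_eq)
    also have "\<dots> = (\<Sum>i=1..n. \<nu> (?X i)) / n + e / 2"
      using n(1) by (simp add: sum.distrib add_divide_distrib)
    also have "(\<Sum>i=1..n. \<nu> (?X i)) / n \<le> val_integral D \<nu> f"
      using \<nu> by (intro val_integral_bounds(1)[OF f _ n(1)]) (simp add: topspace_weak_topology)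
    finally show ?thesis
      using n(2) by simp
  qed
  ultimately show ?thesis by blast
qed

lemma p_valuations_point_continuous:
  fixes D :: "'a::order set" and E :: "'b::order set"
  assumes U: "scott_open (D \<times> E) U" and \<xi>: "\<xi> \<in> valuations E" and "\<nu> \<in> p_valuations D"
  shows "\<nu> \<in> valuations D \<and> point_continuous D \<nu> \<and>
    val_integral D \<nu> (\<lambda>x. \<xi> (U `` {x})) \<le> val_integral E \<xi> (\<lambda>y. \<nu> (U\<inverse> `` {y}))"
proof -
  let ?F = "\<lambda>\<nu>. val_integral D \<nu> (\<lambda>x. \<xi> (U `` {x}))"
  let ?G = "\<lambda>\<nu>. val_integral E \<xi> (\<lambda>y. \<nu> (U\<inverse> `` {y}))"
  define S where "S = {\<nu> \<in> valuations D. point_continuous D \<nu> \<and> ?F \<nu> \<le> ?G \<nu>}"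
  have "simple_valuations D \<subseteq> S"
  proof
    fix \<mu> assume \<mu>: "\<mu> \<in> simple_valuations D"
    from simple_valuations_properties[OF this] have "\<mu> \<in> valuations D" "point_continuous D \<mu>"
      by metis+
    with simple_valuation_integral_le[OF U \<mu> \<xi>] show "\<mu> \<in> S"
      by (simp add: S_def)
  qed
  moreover have "sober_space (subtopology (weak_topology D) S)"
  proof (rule sober_space_weak_subtopologyI)
    fix C \<nu>0 assume C: "C \<subseteq> S" and \<nu>0: "\<nu>0 \<in> valuations D"
      and le: "\<And>\<nu> V. \<nu> \<in> C \<Longrightarrow> scott_open D V \<Longrightarrow> \<nu> V \<le> \<nu>0 V"
      and nbhd: "\<And>W. openin (weak_topology D) W \<Longrightarrow> \<nu>0 \<in> W \<Longrightarrow> W \<inter> C \<noteq> {}"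
    have "point_continuous D \<nu>0"
      unfolding point_continuous_def
    proof (intro allI impI)
      fix V t assume V: "scott_open D V \<and> t < \<nu>0 V"
      then have "{\<nu> \<in> valuations D. t < \<nu> V} \<inter> C \<noteq> {}"
        using \<nu>0 by (intro nbhd openin_weak_superlevel) auto
      then obtain \<nu> where \<nu>: "\<nu> \<in> C" "t < \<nu> V" by blast
      then obtain F where "F \<subseteq> V" "point_bound D \<nu> t F"
        using C V unfolding S_def point_continuous_def by blast
      moreover from this have "point_bound D \<nu>0 t F"
        using le[OF \<nu>(1)] unfolding point_bound_def by (meson less_le_trans)
      ultimately show "\<exists>F\<subseteq>V. point_bound D \<nu>0 t F" by blast
    qed
    \<comment> \<open>For \<open>\<nu>\<close> in \<open>C\<close> close to \<open>\<nu>0\<close>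
      one has \<open>?F \<nu>0 \<le> ?F \<nu> + e \<le> ?G \<nu> + e \<le> ?G \<nu>0 + e\<close>;
      for \<open>?G\<close>, monotonicity is enough.\<close>
    moreover have "?F \<nu>0 \<le> ?G \<nu>0"
    proof (rule field_le_epsilon)
      fix e :: real assume "0 < e"
      obtain W where W: "openin (weak_topology D) W" "\<nu>0 \<in> W" "\<And>\<nu>. \<nu> \<in> W \<Longrightarrow> ?F \<nu>0 \<le> ?F \<nu> + e"
        using val_integral_weak_approx[OF scott_lsc_valuation_Image[OF U \<xi>] \<nu>0 \<open>0 < e\<close>] by blast
      from nbhd[OF W(1,2)] obtain \<nu> where \<nu>: "\<nu> \<in> W" "\<nu> \<in> C" by blast
      have \<nu>V: "\<nu> \<in> valuations D" "?F \<nu> \<le> ?G \<nu>"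
        using \<nu>(2) C by (auto simp: S_def)
      have "?G \<nu> \<le> ?G \<nu>0"
        using le[OF \<nu>(2)] scott_open_Image[OF scott_open_converse[OF U]]
        by (intro val_integral_mono \<xi> scott_lsc_valuation_Image[OF scott_open_converse[OF U]] \<nu>V(1) \<nu>0) auto
      with W(3)[OF \<nu>(1)] \<nu>V(2) show "?F \<nu>0 \<le> ?G \<nu>0 + e" by simp
    qed
    ultimately show "\<nu>0 \<in> S"
      using \<nu>0 by (simp add: S_def)
  qed (auto simp: S_def)
  moreover have "S \<subseteq> valuations D"
    by (auto simp: S_def)
  ultimately have "p_valuations D \<subseteq> S"
    unfolding p_valuations_def by blast
  with assms(3) show ?thesis
    by (auto simp: S_def)
qed

section \<open>Exchanging the iterated integrals\<close>

lemma val_integral_iterated: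
  fixes D :: "'a::order set" and E :: "'b::order set"
  assumes U: "scott_open (D \<times> E) U" and \<xi>: "\<xi> \<in> valuations E"
  shows "val_integral D \<nu> (\<lambda>x. val_integral E \<xi> (\<lambda>y. indicator U (x, y))) =
    val_integral D \<nu> (\<lambda>x. \<xi> (U `` {x}))"
proof -
  have "val_integral E \<xi> (\<lambda>y. indicator U (x, y)) = \<xi> (U `` {x})" if "x \<in> D" for x
  proof -
    have "(\<lambda>y. indicator U (x, y) :: real) = indicator (U `` {x})"
      by (auto simp: indicator_def)
    then show ?thesis
      using val_integral_indicator[OF \<xi> scott_open_Image[OF U that]] by simp
  qed
  then have "{x \<in> D. val_integral E \<xi> (\<lambda>y. indicator U (x, y)) \<in> {t<..1}} =
      {x \<in> D. \<xi> (U `` {x}) \<in> {t<..1}}" for t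
    by auto
  then show ?thesis by (simp add: val_integral_def[of D])
qed

lemma fubini_p_valuations:
  fixes D :: "'a::order set" and E :: "'b::order set"
  assumes U: "scott_open (D \<times> E) U" and \<nu>: "\<nu> \<in> p_valuations D" and \<xi>: "\<xi> \<in> valuations E"
  shows "val_integral D \<nu> (\<lambda>x. val_integral E \<xi> (\<lambda>y. indicator U (x, y))) =
    val_integral E \<xi> (\<lambda>y. val_integral D \<nu> (\<lambda>x. indicator U (x, y)))"
proof -
  note * = p_valuations_point_continuous[OF U \<xi> \<nu>]
  then have "val_integral D \<nu> (\<lambda>x. \<xi> (U `` {x})) = val_integral E \<xi> (\<lambda>y. \<nu> (U\<inverse> `` {y}))"
    using point_continuous_integral_le[OF U _ _ \<xi>] by (intro antisym) auto
  moreover have "val_integral E \<xi> (\<lambda>y. val_integral D \<nu> (\<lambda>x. indicator U (x, y))) =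
      val_integral E \<xi> (\<lambda>y. \<nu> (U\<inverse> `` {y}))"
    using val_integral_iterated[OF scott_open_converse[OF U], of \<nu> \<xi>] * by (simp add: indicator_def)
  ultimately show ?thesis
    by (simp add: val_integral_iterated[OF U \<xi>])
qed

theorem theorem3p14:
  fixes D :: "'a::order set" and E :: "'b::order set" and U :: "('a \<times> 'b) set"
  assumes "dcpo D" and "dcpo E"
    and "openin (scott_topology (D \<times> E)) U"
  shows "(\<forall>\<nu>\<in>p_valuations D. \<forall>\<xi>\<in>valuations E.
            val_integral D \<nu> (\<lambda>x. val_integral E \<xi> (\<lambda>y. indicator U (x, y))) =
            val_integral E \<xi> (\<lambda>y. val_integral D \<nu> (\<lambda>x. indicator U (x, y)))) \<and>
         (\<forall>\<nu>\<in>valuations D. \<forall>\<xi>\<in>p_valuations E.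
            val_integral D \<nu> (\<lambda>x. val_integral E \<xi> (\<lambda>y. indicator U (x, y))) =
            val_integral E \<xi> (\<lambda>y. val_integral D \<nu> (\<lambda>x. indicator U (x, y))))"
proof -
  have U: "scott_open (D \<times> E) U"
    using assms(3) by (simp add: openin_scott_topology)
  have swap: "indicator (U\<inverse>) (y, x) = (indicator U (x, y) :: real)" for x y
    by (simp add: indicator_def)
  show ?thesis
    \<comment> \<open>The second half is the first one for \<open>U\<inverse>\<close>, with the two
      dcpos exchanged.\<close>
    using fubini_p_valuations[OF U] fubini_p_valuations[OF scott_open_converse[OF U]]
    unfolding swap by metis
qed

end
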